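(* Let $\alpha>\alpha^*$, $\eta=\eta_1(\alpha)$, and let $$\alpha_1=-\tfrac{S_4}2,\quad\alpha_2=-\tfrac12\big(1+\tfrac1\lambda\big)S_2,\quad\alpha_3=-\tfrac12\big(1-\tfrac1\lambda\big)S_2,\quad\alpha_4=\tfrac4{15}-\tfrac5{21}S_2-\tfrac1{35}S_4,\quad\alpha_5=\tfrac17S_4+\tfrac67S_2,\quad\alpha_6=\tfrac17S_4-\tfrac17S_2,$$ $\gamma_1=\alpha_3-\alpha_2$, $\gamma_2=\alpha_6-\alpha_5$. Then for any real symmetric $3\times3$ matrix $\mathbf D$ and any $\mathbf n\in\mathbb S^2$, $$\Big(\alpha_1+\frac{\gamma_2^2}{\gamma_1}\Big)|\mathbf D:\mathbf{nn}|^2+\alpha_4\,\mathbf D:\mathbf D+\Big(\alpha_5+\alpha_6-\frac{\gamma_2^2}{\gamma_1}\Big)|\mathbf D\cdot\mathbf n|^2\ge0.$$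
   Context: $\mathbf D:\mathbf{nn}=\sum D_{ij}n_in_j$, $\mathbf D:\mathbf D=\sum D_{ij}^2$. Let $A_k(\eta)=\int_{-1}^1z^ke^{\eta z^2}dz$. The function $A_0(\eta)/(A_2(\eta)-A_4(\eta))$ has minimum value $\alpha^*\approx6.731393$ attained at a unique $\eta^*>0$; for $\alpha>\alpha^*$ the equation $A_0(\eta)=\alpha(A_2(\eta)-A_4(\eta))$ has exactly two solutions $\eta_1(\alpha)>\eta^*>\eta_2(\alpha)$. For $\mathbf n\in\mathbb S^2$, $h_{\eta,\mathbf n}(\mathbf m)=e^{\eta(\mathbf m\cdot\mathbf n)^2}/\int_{\mathbb S^2}e^{\eta(\mathbf m'\cdot\mathbf n)^2}d\mathbf m'$, and $\langle\cdot\rangle_{h}=\int_{\mathbb S^2}(\cdot)h\,d\mathbf m$. $S_2=\langle P_2(\mathbf m\cdot\mathbf n)\rangle_{h_{\eta,\mathbf n}}$, $S_4=\langle P_4(\mathbf m\cdot\mathbf n)\rangle_{h_{\eta,\mathbf n}}$ ($P_k$ Legendre polynomials); these do not depend on $\mathbf n$. Let $\mathcal Uf(\mathbf m)=\alpha\int_{\mathbb S^2}|\mathbf m\times\mathbf m'|^2f(\mathbf m')d\mathbf m'$, $\theta$ the angle between $\mathbf m$ and $\mathbf n$, $u_0(\theta)=\mathcal Uh_{\eta,\mathbf n}$, and let $g_0(\theta)$ be the bounded solution on $(0,\pi)$ of $$\frac1{\sin\theta}\frac{d}{d\theta}\Big(\sin\theta\frac{dg_0}{d\theta}\Big)-\frac{g_0}{\sin^2\theta}-\frac{du_0}{d\theta}\frac{dg_0}{d\theta}=-\frac{du_0}{d\theta}.$$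 Then $\lambda=\langle3(\mathbf m\cdot\mathbf n)^2-1\rangle_{h_{\eta,\mathbf n}}/\langle g_0\frac{du_0}{d\theta}\rangle_{h_{\eta,\mathbf n}}$. *)

theory Defs
  imports "HOL-Analysis.Analysis"
begin

(* Surface measure on the unit sphere of R^3 (total mass 4 pi), obtained from Lebesgue measure by
   polar coordinates: sigma(A) = 3 * volume {x. 0 < |x| < 1, x/|x| : A}, where sgn x = x/|x|.
   Its underlying space is the sphere itself. *)
definition sphere_measure :: "(real^3) measure" where
  "sphere_measure =
     scale_measure 3
       (distr (restrict_space lborel (ball 0 1 - {0})) (restrict_space borel (sphere 0 1)) sgn)"

lemma space_sphere_measure: "space sphere_measure = sphere 0 1"
  by (simp add: sphere_measure_def space_scale_measure space_restrict_space)

lemma emeasure_sphere_measure: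
  assumes "A \<in> sets (restrict_space borel (sphere 0 1))"
  shows "emeasure sphere_measure A = 3 * emeasure lborel {x \<in> ball 0 1 - {0}. sgn x \<in> A}"
proof -
  let ?B = "ball 0 1 - {0} :: (real^3) set"
  have m: "sgn \<in> measurable (restrict_space lborel ?B) (restrict_space borel (sphere 0 1))"
  proof (rule measurable_restrict_space2)
    show "sgn \<in> space (restrict_space lborel ?B) \<rightarrow> sphere (0 :: real^3) 1"
      by (auto simp: space_restrict_space norm_sgn)
    have "(\<lambda>x :: real^3. x /\<^sub>R norm x) \<in> borel_measurable borel"
      by measurable
    then have "(sgn :: real^3 \<Rightarrow> real^3) \<in> borel_measurable lborel"
      by (simp add: sgn_div_norm[abs_def])
    then show "sgn \<in> borel_measurable (restrict_space lborel ?B)"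
      by (rule measurable_restrict_space1)
  qed
  have eq: "sgn -` A \<inter> space (restrict_space lborel ?B) = {x \<in> ?B. sgn x \<in> A}"
    by (auto simp: space_restrict_space)
  have "emeasure sphere_measure A = 3 * emeasure (restrict_space lborel ?B) {x \<in> ?B. sgn x \<in> A}"
    unfolding sphere_measure_def emeasure_scale_measure emeasure_distr[OF m assms] eq by simp
  also have "emeasure (restrict_space lborel ?B) {x \<in> ?B. sgn x \<in> A} =
      emeasure lborel {x \<in> ?B. sgn x \<in> A}"
    by (rule emeasure_restrict_space) auto
  finally show ?thesis .
qed

lemma emeasure_sphere_measure_space: "emeasure sphere_measure (sphere 0 1) = ennreal (4 * pi)"
proof -
  have "{x \<in> ball 0 1 - {0}. sgn x \<in> sphere (0 :: real^3) 1} = ball 0 1 - {0}"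
    by (auto simp: norm_sgn)
  moreover have "sphere 0 1 \<in> sets (restrict_space borel (sphere (0 :: real^3) 1))"
    using sets.top[of "restrict_space borel (sphere (0 :: real^3) 1)"] by (simp add: space_restrict_space)
  ultimately have "emeasure sphere_measure (sphere 0 1) = 3 * emeasure lborel (ball 0 1 - {0} :: (real^3) set)"
    by (simp add: emeasure_sphere_measure)
  also have "emeasure lborel (ball 0 1 - {0} :: (real^3) set) = emeasure lborel (ball 0 1 :: (real^3) set)"
    by (rule emeasure_Diff_null_set) auto
  also have "\<dots> = ennreal (4 / 3 * pi)"
    by (simp add: emeasure_ball unit_ball_vol_3)
  also have "3 * ennreal (4 / 3 * pi) = ennreal (4 * pi)"
    by (subst ennreal_numeral[symmetric], subst ennreal_mult[symmetric]) auto
  finally show ?thesis .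
qed

definition A :: "nat \<Rightarrow> real \<Rightarrow> real" where
  "A k \<eta> = integral {-1..1} (\<lambda>z. z ^ k * exp (\<eta> * z\<^sup>2))"

definition ratio :: "real \<Rightarrow> real" where
  "ratio \<eta> = A 0 \<eta> / (A 2 \<eta> - A 4 \<eta>)"

definition alpha_star :: real where
  "alpha_star = (INF \<eta>. ratio \<eta>)"

(* Legendre polynomials, by Bonnet's recursion. *)
fun legendre :: "nat \<Rightarrow> real \<Rightarrow> real" where
  "legendre 0 x = 1"
| "legendre (Suc 0) x = x"
| "legendre (Suc (Suc k)) x =
     ((2 * real k + 3) * x * legendre (Suc k) x - (real k + 1) * legendre k x) / (real k + 2)"

definition h :: "real \<Rightarrow> real^3 \<Rightarrow> real^3 \<Rightarrow> real" where
  "h \<eta> n m = exp (\<eta> * (m \<bullet> n)\<^sup>2) / (LINT m'|sphere_measure. exp (\<eta> * (m' \<bullet> n)\<^sup>2))"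

definition avg :: "(real^3 \<Rightarrow> real) \<Rightarrow> (real^3 \<Rightarrow> real) \<Rightarrow> real" where
  "avg f \<phi> = (LINT m|sphere_measure. \<phi> m * f m)"

definition order_param :: "nat \<Rightarrow> real \<Rightarrow> real^3 \<Rightarrow> real" where
  "order_param k \<eta> n = avg (h \<eta> n) (\<lambda>m. legendre k (m \<bullet> n))"

definition U :: "real \<Rightarrow> (real^3 \<Rightarrow> real) \<Rightarrow> real^3 \<Rightarrow> real" where
  "U \<alpha> f m = \<alpha> * (LINT m'|sphere_measure. (norm (cross3 m m'))\<^sup>2 * f m')"

(* u is the function of the polar angle about n that represents U h. This determines u on [0, pi]
   only, which is all that is used below. *)
definition is_potential :: "real \<Rightarrow> real \<Rightarrow> real^3 \<Rightarrow> (real \<Rightarrow> real) \<Rightarrow> bool" where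
  "is_potential \<alpha> \<eta> n u \<longleftrightarrow>
     (\<forall>m. norm m = 1 \<longrightarrow> u (arccos (m \<bullet> n)) = U \<alpha> (h \<eta> n) m)"

definition is_bounded_solution :: "(real \<Rightarrow> real) \<Rightarrow> (real \<Rightarrow> real) \<Rightarrow> bool" where
  "is_bounded_solution u g \<longleftrightarrow>
     bounded (g ` {0<..<pi}) \<and>
     (\<forall>\<theta>\<in>{0<..<pi}.
        g differentiable (at \<theta>) \<and>
        (\<lambda>t. sin t * deriv g t) differentiable (at \<theta>) \<and>
        1 / sin \<theta> * deriv (\<lambda>t. sin t * deriv g t) \<theta> - g \<theta> / (sin \<theta>)\<^sup>2 - deriv u \<theta> * deriv g \<theta>
          = - deriv u \<theta>)"

definition leslie_lambda :: "real \<Rightarrow> real^3 \<Rightarrow> (real \<Rightarrow> real) \<Rightarrow> (real \<Rightarrow> real) \<Rightarrow> real" where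
  "leslie_lambda \<eta> n u g =
     avg (h \<eta> n) (\<lambda>m. 3 * (m \<bullet> n)\<^sup>2 - 1) /
     avg (h \<eta> n) (\<lambda>m. g (arccos (m \<bullet> n)) * deriv u (arccos (m \<bullet> n)))"

definition ddot :: "real^3^3 \<Rightarrow> real^3^3 \<Rightarrow> real" where
  "ddot X Y = (\<Sum>i\<in>UNIV. \<Sum>j\<in>UNIV. X $ i $ j * Y $ i $ j)"

definition outer :: "real^3 \<Rightarrow> real^3 \<Rightarrow> real^3^3" where
  "outer v w = (\<chi> i j. v $ i * w $ j)"

end

theory Submission
  imports Defs
begin

text \<open>
  Write \<open>a\<close> and \<open>b\<close> for the averages of \<open>(m \<bullet> e)\<^sup>2\<close> and \<open>(m \<bullet> e) ^ 4\<close> under the equilibrium density, and \<open>G\<close> for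
  the average of \<open>g0 u0'\<close>. Then \<open>S2 = (3 a - 1) / 2\<close>, \<open>S4 = (35 b - 30 a + 3) / 8\<close>, \<open>lam = (3 a - 1) / G\<close> and
  \<open>\<gamma>2\<^sup>2 / \<gamma>1 = lam * S2\<close>.

  Relative to \<open>n\<close> the quadratic form is diagonal (\<open>quadratic_form_nonneg\<close>), and its coefficients are
  \<open>\<alpha>4 = (3 - 2 a - b) / 8\<close>, \<open>\<alpha>1 + \<alpha>4 + \<alpha>5 + \<alpha>6 = (26 a - 17 b - 1) / 16\<close> and
  \<open>2 \<alpha>4 + \<alpha>5 + \<alpha>6 - lam S2 = ((1 - a + 2 b) - (3 a - 1)\<^sup>2 / G) / 2\<close>. The first two are nonnegative because
  \<open>b \<le> a \<le> 1\<close> and \<open>a \<ge> 1 / 3\<close>; the latter holds since integration by parts gives \<open>3 a - 1 = 2 \<eta> (a - b)\<close> (\<open>A_parts\<close>)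
  and \<open>\<eta> > 0\<close>.

  The third coefficient needs a lower bound for \<open>G\<close>. The equation for \<open>\<eta>\<close> makes the density self-consistent:
  \<open>u0 = const - \<eta> cos\<^sup>2 \<theta>\<close>, so the density is proportional to \<open>exp (- u0)\<close>, and the equation for \<open>g0\<close> is the
  Euler-Lagrange equation of \<open>\<phi> \<mapsto> 2 \<langle>u0' \<phi>\<rangle> - \<langle>\<phi>'\<^sup>2 + \<phi>\<^sup>2 / sin\<^sup>2 \<theta>\<rangle>\<close>, whose maximum is \<open>G\<close>. The test functions
  \<open>c sin \<theta> cos \<theta>\<close> are proportional to \<open>u0'\<close>; for them \<open>\<langle>u0' \<phi>\<rangle> = c (3 a - 1)\<close> and the energy is \<open>c\<^sup>2 (1 - 3 a + 4 b)\<close>, so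
  optimising \<open>c\<close> yields \<open>(3 a - 1)\<^sup>2 \<le> G (1 - 3 a + 4 b)\<close> (\<open>dual_energy_bound\<close>). As \<open>b \<le> a\<close>, the last factor is at most
  \<open>1 - a + 2 b\<close>.

  Two points need care. The solution is only known to be bounded on the open interval, so the boundary terms at the
  poles must be excluded: a nonvanishing one would make a bounded function grow logarithmically
  (\<open>unbounded_of_weighted_deriv_le\<close>, \<open>integral_energy_gap_nonneg\<close>). And averages over the sphere must be turned into
  integrals over \<open>[-1, 1]\<close>: this is Archimedes' theorem (\<open>distr_inner_sphere_measure\<close>), which is derived from the polar
  definition of the surface measure, and the invariance under reflections gives the potential (\<open>U_h\<close>).
\<close>

section \<open>Orthogonal invariance of the surface measure\<close>

text \<open>
  Two Borel measures that give every open box its volume coincide, so it is enough to treat the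
  preimage of a box. That preimage is an orthogonal image of the box, hence of equal volume.
\<close>

lemma lborel_orthogonal_transformation:
  fixes R :: "real^'n::{finite, wellorder} \<Rightarrow> real^'n::_"
  assumes R: "orthogonal_transformation R"
  shows "distr lborel borel R = lborel"
proof (rule lborel_eqI[symmetric])
  have lin: "linear R" and inj: "bij R"
    using R by (auto simp: orthogonal_transformation_linear orthogonal_transformation_bij)
  have [measurable]: "R \<in> borel_measurable borel"
    by (intro borel_measurable_continuous_onI linear_continuous_on linear_linear[THEN iffD2] lin)
  fix l u :: "real^'n::_" assume "\<And>b. b \<in> Basis \<Longrightarrow> l \<bullet> b \<le> u \<bullet> b"
  then have box: "emeasure lborel (box l u) = (\<Prod>b\<in>Basis. (u - l) \<bullet> b)"
    by simp
  let ?P = "R -` box l u"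
  have P: "?P = inv R ` box l u"
    using inj by (simp add: bij_vimage_eq_inv_image)
  have oi: "orthogonal_transformation (inv R)"
    using R by (rule orthogonal_transformation_inv)
  have lm: "box l u \<in> lmeasurable" by simp
  have sets: "?P \<in> sets borel" by (rule measurable_sets_borel[OF _ borel_open]) auto
  have "emeasure lborel ?P = emeasure lebesgue ?P"
    using sets by simp
  also have "\<dots> = ennreal (measure lebesgue ?P)"
    unfolding P using measurable_orthogonal_image[OF oi lm]
    by (simp add: emeasure_eq_ennreal_measure lmeasurable_iff_has_integral fmeasurableD2)
  also have "measure lebesgue ?P = measure lebesgue (box l u)"
    unfolding P by (rule measure_orthogonal_image[OF oi lm])
  also have "ennreal \<dots> = emeasure lebesgue (box l u)"
    using lm by (simp add: emeasure_eq_ennreal_measure fmeasurableD2)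
  also have "\<dots> = emeasure lborel (box l u)" by simp
  finally show "emeasure (distr lborel borel R) (box l u) = (\<Prod>b\<in>Basis. (u - l) \<bullet> b)"
    by (simp add: emeasure_distr box)
qed simp

lemma sets_sphere_measure [measurable_cong]:
  "sets sphere_measure = sets (restrict_space borel (sphere 0 1))"
  by (simp add: sphere_measure_def)

lemma finite_sphere_measure: "finite_measure sphere_measure"
  by (rule finite_measureI) (simp add: space_sphere_measure emeasure_sphere_measure_space)

lemma measurable_orthogonal_sphere_measure:
  fixes R :: "real^3 \<Rightarrow> real^3"
  assumes R: "orthogonal_transformation R"
  shows "R \<in> measurable sphere_measure sphere_measure"
proof -
  have "R \<in> borel_measurable borel"
    by (intro borel_measurable_continuous_onI linear_continuous_on linear_linear[THEN iffD2]
        orthogonal_transformation_linear R)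
  then have "R \<in> measurable (restrict_space borel (sphere 0 1)) (restrict_space borel (sphere 0 1))"
    using R by (intro measurable_restrict_space3) (auto simp: orthogonal_transformation_norm)
  then show ?thesis
    by (simp add: measurable_cong_sets[OF sets_sphere_measure sets_sphere_measure])
qed

text \<open>
  Radial projection onto the sphere commutes with an orthogonal map, and the ball is invariant
  under it, so the invariance of volume descends to the sphere.
\<close>

lemma sphere_measure_orthogonal_transformation:
  fixes R :: "real^3 \<Rightarrow> real^3"
  assumes R: "orthogonal_transformation R"
  shows "distr sphere_measure sphere_measure R = sphere_measure"
proof (rule measure_eqI)
  have lin: "linear R" using R by (simp add: orthogonal_transformation_linear)
  have Rb [measurable]: "R \<in> borel_measurable borel"
    by (intro borel_measurable_continuous_onI linear_continuous_on linear_linear[THEN iffD2] lin)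
  note Rm = measurable_orthogonal_sphere_measure[OF R]
  fix B assume "B \<in> sets (distr sphere_measure sphere_measure R)"
  then have B: "B \<in> sets (restrict_space borel (sphere 0 1))"
    by (simp add: sets_sphere_measure)
  have nR: "norm (R x) = norm x" for x using R by (simp add: orthogonal_transformation_norm)
  have sgnR: "sgn (R x) = R (sgn x)" for x
    by (simp add: sgn_div_norm nR linear_cmul[OF lin])
  have RB: "R -` B \<inter> sphere 0 1 \<in> sets (restrict_space borel (sphere 0 1))"
    using measurable_sets[OF Rm, of B] B by (simp add: sets_sphere_measure space_sphere_measure)
  let ?C = "{x \<in> ball 0 1 - {0}. sgn x \<in> B}"
  have B': "B \<in> sets borel"
    using B by (auto simp: sets_restrict_space_iff)
  have [measurable]: "(sgn :: real^3 \<Rightarrow> real^3) \<in> borel_measurable borel"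
  proof -
    have "(\<lambda>x :: real^3. x /\<^sub>R norm x) \<in> borel_measurable borel" by measurable
    then show ?thesis by (simp add: sgn_div_norm[abs_def])
  qed
  have C: "?C \<in> sets borel"
    using B' by measurable
  have "emeasure (distr sphere_measure sphere_measure R) B = emeasure sphere_measure (R -` B \<inter> sphere 0 1)"
    using Rm B by (simp add: emeasure_distr sets_sphere_measure space_sphere_measure)
  also have "\<dots> = 3 * emeasure lborel {x \<in> ball 0 1 - {0}. sgn x \<in> R -` B \<inter> sphere 0 1}"
    by (rule emeasure_sphere_measure[OF RB])
  also have "{x \<in> ball 0 1 - {0}. sgn x \<in> R -` B \<inter> sphere 0 1} = R -` ?C"
  proof -
    have "R x = 0 \<longleftrightarrow> x = 0" for x using nR[of x] by (metis norm_eq_zero)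
    then show ?thesis by (auto simp: nR sgnR norm_sgn)
  qed
  also have "emeasure lborel (R -` ?C) = emeasure (distr lborel borel R) ?C"
    using C by (simp add: emeasure_distr)
  also have "\<dots> = emeasure lborel ?C" by (simp add: lborel_orthogonal_transformation[OF R])
  finally show "emeasure (distr sphere_measure sphere_measure R) B = emeasure sphere_measure B"
    by (simp add: emeasure_sphere_measure[OF B])
qed simp

lemma sphere_integral_orthogonal_transformation:
  fixes R :: "real^3 \<Rightarrow> real^3" and f :: "real^3 \<Rightarrow> real"
  assumes R: "orthogonal_transformation R" and f: "f \<in> borel_measurable sphere_measure"
  shows "(LINT m|sphere_measure. f (R m)) = (LINT m|sphere_measure. f m)"
  using integral_distr[OF measurable_orthogonal_sphere_measure[OF R] f]
  by (simp add: sphere_measure_orthogonal_transformation[OF R])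

section \<open>Archimedes' theorem: the height on the sphere is uniformly distributed\<close>

text \<open>
  Space is written as plane times axis: Fubini then integrates along the axis first, where the
  height-to-radius ratio can be taken as the new variable.
\<close>

definition of_plane_axis :: "(real \<times> real) \<times> real \<Rightarrow> real^3" where
  "of_plane_axis p = fst (fst p) *\<^sub>R axis 1 1 + snd (fst p) *\<^sub>R axis 2 1 + snd p *\<^sub>R axis 3 1"

lemma of_plane_axis_nth [simp]: "of_plane_axis p $ 1 = fst (fst p)" "of_plane_axis p $ 2 = snd (fst p)" "of_plane_axis p $ 3 = snd p"
  by (simp_all add: of_plane_axis_def axis_def)

lemma norm_of_plane_axis: "norm (of_plane_axis p) = sqrt ((norm (fst p))\<^sup>2 + (snd p)\<^sup>2)"
  by (simp add: norm_vec_def L2_set_def sum_3 norm_Pair norm_prod_def)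

lemma of_plane_axis_measurable [measurable]: "of_plane_axis \<in> borel_measurable (borel \<Otimes>\<^sub>M borel)"
  unfolding of_plane_axis_def borel_prod[symmetric] by measurable

lemma distr_of_plane_axis: "distr (lborel \<Otimes>\<^sub>M lborel) borel of_plane_axis = lborel"
proof (rule lborel_eqI[symmetric])
  fix l u :: "real^3" assume "\<And>b. b \<in> Basis \<Longrightarrow> l \<bullet> b \<le> u \<bullet> b"
  then have le: "l $ i \<le> u $ i" for i
    by (metis axis_in_Basis_iff cart_eq_inner_axis Basis_real_def insertI1)
  have [measurable]: "of_plane_axis \<in> borel_measurable (lborel \<Otimes>\<^sub>M lborel)"
    using of_plane_axis_measurable by (simp add: measurable_cong_sets[OF sets_pair_measure_cong[OF sets_lborel sets_lborel]])
  have "emeasure (distr (lborel \<Otimes>\<^sub>M lborel) borel of_plane_axis) (box l u) = emeasure (lborel \<Otimes>\<^sub>M lborel)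
      ((({l$1<..<u$1} \<times> {l$2<..<u$2}) \<times> {l$3<..<u$3}))"
    by (subst emeasure_distr) (auto intro!: arg_cong2[where f = emeasure] 
        simp: mem_box_cart forall_3 space_pair_measure)
  also have "\<dots> = emeasure (lborel \<Otimes>\<^sub>M lborel) ({l$1<..<u$1} \<times> {l$2<..<u$2}) * ennreal (u$3 - l$3)"
    using le by (subst lborel.emeasure_pair_measure_Times) (auto simp: lborel_prod open_Times)
  also have "\<dots> = ennreal (u$1 - l$1) * ennreal (u$2 - l$2) * ennreal (u$3 - l$3)"
    using le by (subst lborel.emeasure_pair_measure_Times) auto
  also have "\<dots> = ennreal ((u$1 - l$1) * (u$2 - l$2) * (u$3 - l$3))"
    using le by (simp add: ennreal_mult'')
  also have "(u$1 - l$1) * (u$2 - l$2) * (u$3 - l$3) = (\<Prod>b\<in>Basis. (u - l) \<bullet> b)"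
  proof -
    have "(Basis :: (real^3) set) = (\<lambda>i. axis i 1) ` UNIV"
      by (auto simp: Basis_vec_def)
    moreover have "inj (\<lambda>i::3. axis i (1::real))"
      by (auto simp: inj_on_def axis_eq_axis)
    ultimately have "(\<Prod>b\<in>Basis. (u - l) \<bullet> b) = (\<Prod>i\<in>UNIV. (u - l) \<bullet> axis i 1)"
      by (auto intro: prod.reindex_cong)
    also have "\<dots> = (u$1 - l$1) * (u$2 - l$2) * (u$3 - l$3)"
      unfolding UNIV_3 by (simp add: inner_axis)
    finally show ?thesis by simp
  qed
  finally show "emeasure (distr (lborel \<Otimes>\<^sub>M lborel) borel of_plane_axis) (box l u) = ennreal (\<Prod>b\<in>Basis. (u - l) \<bullet> b)" .
qed simp

text \<open>
  On the line parallel to the axis at distance \<open>\<rho>\<close>, the point at height \<open>t\<close> projects radially to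
  the sphere at height \<open>z = t / sqrt (\<rho>\<^sup>2 + t\<^sup>2)\<close>. Inverting gives \<open>t = \<rho> z / sqrt (1 - z\<^sup>2)\<close>,
  whose derivative is the weight on the right; the point lies in the ball iff \<open>\<rho>\<^sup>2 + z\<^sup>2 < 1\<close>.
  Staying away from \<open>z = \<plusminus>1\<close> keeps the substitution on a compact interval.
\<close>

lemma nn_integral_cosine_slice:
  fixes \<rho> s :: real
  assumes \<rho>: "\<rho> > 0" and s: "0 \<le> s" "s < 1" and B: "B \<in> sets borel" "B \<subseteq> {-s..s}"
  shows "(\<integral>\<^sup>+t. indicator {t. \<rho>\<^sup>2 + t\<^sup>2 < 1 \<and> t / sqrt (\<rho>\<^sup>2 + t\<^sup>2) \<in> B} t \<partial>lborel) =
    (\<integral>\<^sup>+z. ennreal (indicator B z * indicator {..<1} (\<rho>\<^sup>2 + z\<^sup>2) * (\<rho> / (sqrt (1 - z\<^sup>2)) ^ 3)) \<partial>lborel)"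
proof -
  define g where "g z = \<rho> * z / sqrt (1 - z\<^sup>2)" for z
  define g' where "g' z = \<rho> / (sqrt (1 - z\<^sup>2)) ^ 3" for z
  define S where "S = {t. \<rho>\<^sup>2 + t\<^sup>2 < 1 \<and> t / sqrt (\<rho>\<^sup>2 + t\<^sup>2) \<in> B}"
  note [measurable] = B(1)
  have Sm [measurable]: "S \<in> sets borel" unfolding S_def by measurable
  have pos: "1 - z\<^sup>2 > 0" if "z \<in> {-s..s}" for z
  proof -
    have "\<bar>z\<bar> < 1" using that s by auto
    then show ?thesis by (simp add: abs_square_less_1)
  qed
  have der: "(g has_real_derivative g' z) (at z)" if "z \<in> {-s..s}" for z
  proof -
    note p = pos[OF that]
    define q where "q = sqrt (1 - z\<^sup>2)"
    have q: "q > 0" "q\<^sup>2 = 1 - z\<^sup>2" using p by (auto simp: q_def)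
    have "(g has_real_derivative (\<rho> * q - \<rho> * z * (- z / q)) / (q * q)) (at z)"
      unfolding g_def q_def using p
      by (auto intro!: derivative_eq_intros simp: field_simps)
    moreover have "(\<rho> * q - \<rho> * z * (- z / q)) / (q * q) = \<rho> * (q\<^sup>2 + z\<^sup>2) / q ^ 3"
      using q(1) by (simp add: field_simps power2_eq_square power3_eq_cube)
    ultimately show ?thesis using q by (simp add: g'_def q_def)
  qed
  have cont: "continuous_on {-s..s} g'"
    unfolding g'_def using pos by (auto intro!: continuous_intros simp: less_le)
  have inv: "\<rho>\<^sup>2 + (g z)\<^sup>2 = \<rho>\<^sup>2 / (1 - z\<^sup>2)" "g z / sqrt (\<rho>\<^sup>2 + (g z)\<^sup>2) = z" if "z \<in> {-s..s}" for z
  proof -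
    note p = pos[OF that]
    define q where "q = sqrt (1 - z\<^sup>2)"
    have q: "q > 0" "q\<^sup>2 = 1 - z\<^sup>2" using p by (auto simp: q_def)
    have "\<rho>\<^sup>2 + (\<rho> * z / q)\<^sup>2 = \<rho>\<^sup>2 * (q\<^sup>2 + z\<^sup>2) / q\<^sup>2"
      using q(1) by (simp add: field_simps)
    then show *: "\<rho>\<^sup>2 + (g z)\<^sup>2 = \<rho>\<^sup>2 / (1 - z\<^sup>2)" using q by (simp add: g_def q_def)
    show "g z / sqrt (\<rho>\<^sup>2 + (g z)\<^sup>2) = z"
      unfolding * using \<rho> p by (simp add: g_def real_sqrt_divide)
  qed
  have g_onto: "t \<in> {g (-s)..g s}" if "t \<in> S" for t
  proof -
    define z where "z = t / sqrt (\<rho>\<^sup>2 + t\<^sup>2)"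
    have pp: "\<rho>\<^sup>2 + t\<^sup>2 > 0" using \<rho> by (simp add: add_pos_nonneg)
    have z: "z \<in> {-s..s}" using that B(2) by (auto simp: S_def z_def)
    have "1 - z\<^sup>2 = \<rho>\<^sup>2 / (\<rho>\<^sup>2 + t\<^sup>2)"
      using pp by (auto simp: z_def power_divide divide_simps)
    then have "g z = t"
      using \<rho> pp by (simp add: g_def z_def real_sqrt_divide)
    moreover have "mono_on {-s..s} g"
    proof (rule mono_onI)
      fix x y assume xy: "x \<in> {-s..s}" "y \<in> {-s..s}" "x \<le> y"
      show "g x \<le> g y"
      proof (rule DERIV_nonneg_imp_nondecreasing[OF xy(3)])
        fix w assume "x \<le> w" "w \<le> y"
        then have w: "w \<in> {-s..s}" using xy by auto
        show "\<exists>y. (g has_real_derivative y) (at w) \<and> 0 \<le> y"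
          using der[OF w] \<rho> pos[OF w] by (intro exI[of _ "g' w"]) (simp add: g'_def)
      qed
    qed
    ultimately show ?thesis
      using z s by (auto dest: mono_onD[of "{-s..s}" g "-s" z] mono_onD[of "{-s..s}" g z s])
  qed
  have "(\<integral>\<^sup>+t. indicator S t \<partial>lborel) = (\<integral>\<^sup>+t. ennreal (indicator S t) * indicator {g (-s)..g s} t \<partial>lborel)"
    using g_onto by (intro nn_integral_cong) (auto simp: indicator_def)
  also have "\<dots> = (\<integral>\<^sup>+t. ennreal (indicator S t * indicator {g (-s)..g s} t) \<partial>lborel)"
    by (intro nn_integral_cong) (auto simp: indicator_def)
  also have "\<dots> = (\<integral>\<^sup>+z. ennreal (indicator S (g z) * g' z * indicator {-s..s} z) \<partial>lborel)"
  proof (rule nn_integral_substitution)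
    show "set_borel_measurable borel {g (- s)..g s} (indicator S :: real \<Rightarrow> real)"
      unfolding set_borel_measurable_def by measurable
  qed (use der cont s \<rho> pos in \<open>auto simp: g'_def less_imp_le\<close>)
  also have "\<dots> = (\<integral>\<^sup>+z. ennreal (indicator B z * indicator {..<1} (\<rho>\<^sup>2 + z\<^sup>2) * (\<rho> / (sqrt (1 - z\<^sup>2)) ^ 3)) \<partial>lborel)"
  proof (intro nn_integral_cong arg_cong[where f = ennreal])
    fix z
    show "indicator S (g z) * g' z * indicator {-s..s} z = 
      indicator B z * indicator {..<1} (\<rho>\<^sup>2 + z\<^sup>2) * (\<rho> / (sqrt (1 - z\<^sup>2)) ^ 3)"
    proof (cases "z \<in> {-s..s}")
      case True
      have "\<rho>\<^sup>2 + (g z)\<^sup>2 < 1 \<longleftrightarrow> \<rho>\<^sup>2 + z\<^sup>2 < 1"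
        unfolding inv(1)[OF True] using pos[OF True] by (auto simp: divide_less_eq)
      then have "g z \<in> S \<longleftrightarrow> z \<in> B \<and> \<rho>\<^sup>2 + z\<^sup>2 < 1"
        by (auto simp: S_def inv(2)[OF True])
      then show ?thesis using True by (auto simp: indicator_def g'_def)
    next
      case False
      then have "z \<notin> B" using B(2) by auto
      then show ?thesis using False by simp
    qed
  qed
  finally show ?thesis by (simp add: S_def)
qed

text \<open>
  The exponent 3 is what cancels the factor \<open>(sqrt (1 - z\<^sup>2)) ^ 3\<close> of the slices: this is the reason
  why the distribution of the height has constant density.
\<close>

lemma nn_integral_norm_disc:
  fixes s :: real
  assumes "s > 0"
  shows "(\<integral>\<^sup>+y. ennreal (indicator {..<s} (norm y) * norm y) \<partial>(lborel :: (real \<times> real) measure)) =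
    ennreal (s ^ 3) * (\<integral>\<^sup>+y. ennreal (indicator {..<1} (norm y) * norm y) \<partial>(lborel :: (real \<times> real) measure))"
proof -
  have "(\<integral>\<^sup>+y. ennreal (indicator {..<s} (norm y) * norm y) \<partial>(lborel :: (real \<times> real) measure)) =
    (\<integral>\<^sup>+y. ennreal (indicator {..<s} (norm y) * norm y) \<partial>density (distr (lborel :: (real \<times> real) measure) borel (\<lambda>x. 0 + s *\<^sub>R x)) (\<lambda>_. \<bar>s\<bar>^DIM(real \<times> real)))"
    using assms by (subst lborel_affine[of s 0]) auto
  also have "\<dots> = (\<integral>\<^sup>+y. ennreal (s\<^sup>2) * ennreal (indicator {..<s} (norm (s *\<^sub>R y)) * norm (s *\<^sub>R y)) \<partial>(lborel :: (real \<times> real) measure))"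
    by (subst nn_integral_density) (auto simp: nn_integral_distr power2_eq_square ennreal_power[symmetric] eval_nat_numeral ennreal_mult'')
  also have "\<dots> = (\<integral>\<^sup>+y. ennreal (s ^ 3) * ennreal (indicator {..<1} (norm y) * norm y) \<partial>(lborel :: (real \<times> real) measure))"
    using assms by (intro nn_integral_cong) 
      (auto simp: indicator_def ennreal_mult[symmetric] power2_eq_square power3_eq_cube mult_ac split: if_splits)
  also have "\<dots> = ennreal (s ^ 3) * (\<integral>\<^sup>+y. ennreal (indicator {..<1} (norm y) * norm y) \<partial>(lborel :: (real \<times> real) measure))"
    by (rule nn_integral_cmult) auto
  finally show ?thesis .
qed

text \<open>
  After exchanging the integrals over the plane and over \<open>z\<close>, the plane integral is one over a disc of
  radius \<open>sqrt (1 - z\<^sup>2)\<close>, and by scaling it does not depend on \<open>z\<close>.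
\<close>

lemma emeasure_zone_slab:
  fixes s :: real
  defines "K \<equiv> (\<integral>\<^sup>+y. ennreal (indicator {..<1} (norm y) * norm y) \<partial>(lborel :: (real \<times> real) measure))"
  assumes s: "0 \<le> s" "s < 1" and B: "B \<in> sets borel" "B \<subseteq> {-s..s}"
  shows "emeasure sphere_measure {m \<in> sphere 0 1. m $ 3 \<in> B} = 3 * K * emeasure lborel B"
proof -
  note [measurable] = B(1)
  define W where "W = {x \<in> ball 0 1 - {0 :: real^3}. x $ 3 / norm x \<in> B}"
  have [measurable]: "(\<lambda>x :: real^3. x $ 3) \<in> borel_measurable borel"
    by (intro borel_measurable_continuous_onI continuous_intros)
  have W [measurable]: "W \<in> sets borel" unfolding W_def by measurable
  have "{m \<in> sphere 0 1. m $ 3 \<in> B} \<in> sets (restrict_space borel (sphere (0 :: real^3) 1))"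
    by (subst sets_restrict_space_iff) (auto, measurable)
  then have "emeasure sphere_measure {m \<in> sphere 0 1. m $ 3 \<in> B} = 
    3 * emeasure lborel {x \<in> ball 0 1 - {0}. sgn x \<in> {m \<in> sphere (0 :: real^3) 1. m $ 3 \<in> B}}"
    by (rule emeasure_sphere_measure)
  also have "{x \<in> ball 0 1 - {0}. sgn x \<in> {m \<in> sphere (0 :: real^3) 1. m $ 3 \<in> B}} = W"
    unfolding W_def by (auto simp: norm_sgn) (auto simp: sgn_div_norm field_simps)
  also have "emeasure lborel W = (\<integral>\<^sup>+x. indicator W x \<partial>lborel)" by simp
  also have "\<dots> = (\<integral>\<^sup>+p. indicator W (of_plane_axis p) \<partial>(lborel \<Otimes>\<^sub>M lborel))"
    by (subst distr_of_plane_axis[symmetric], subst nn_integral_distr) auto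
  also have "\<dots> = (\<integral>\<^sup>+y. \<integral>\<^sup>+t. indicator W (of_plane_axis (y, t)) \<partial>lborel \<partial>lborel)"
    by (subst lborel.nn_integral_fst[symmetric]) auto
  also have "\<dots> = (\<integral>\<^sup>+y. \<integral>\<^sup>+z. ennreal (indicator B z * indicator {..<1} ((norm y)\<^sup>2 + z\<^sup>2) * 
      (norm y / (sqrt (1 - z\<^sup>2)) ^ 3)) \<partial>lborel \<partial>(lborel :: (real \<times> real) measure))"
  proof (rule nn_integral_cong_AE)
    have "AE y in lborel. y \<noteq> (0 :: real \<times> real)" by (rule AE_lborel_singleton)
    then show "AE y :: real \<times> real in lborel. (\<integral>\<^sup>+t. indicator W (of_plane_axis (y, t)) \<partial>lborel) = 
       (\<integral>\<^sup>+z. ennreal (indicator B z * indicator {..<1} ((norm y)\<^sup>2 + z\<^sup>2) * 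
      (norm y / (sqrt (1 - z\<^sup>2)) ^ 3)) \<partial>lborel)"
    proof eventually_elim
      case (elim y)
      have "of_plane_axis (y, t) \<noteq> 0" for t
        using elim norm_of_plane_axis[of "(y, t)"] by (auto simp: sum_power2_eq_zero_iff)
      then have "(indicator W (of_plane_axis (y, t)) :: ennreal) = 
          indicator {t. (norm y)\<^sup>2 + t\<^sup>2 < 1 \<and> t / sqrt ((norm y)\<^sup>2 + t\<^sup>2) \<in> B} t" for t
        by (auto simp: W_def indicator_def norm_of_plane_axis)
      then show ?case
        using nn_integral_cosine_slice[of "norm y" s B] s B elim by simp
    qed
  qed
  also have "\<dots> = (\<integral>\<^sup>+z. \<integral>\<^sup>+y. ennreal (indicator B z * indicator {..<1} ((norm y)\<^sup>2 + z\<^sup>2) * 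
      (norm y / (sqrt (1 - z\<^sup>2)) ^ 3)) \<partial>(lborel :: (real \<times> real) measure) \<partial>lborel)"
    by (rule lborel_pair.Fubini') measurable
  also have "\<dots> = (\<integral>\<^sup>+z. K * indicator B z \<partial>lborel)"
  proof (intro nn_integral_cong)
    fix z
    show "(\<integral>\<^sup>+y. ennreal (indicator B z * indicator {..<1} ((norm y)\<^sup>2 + z\<^sup>2) * 
      (norm y / (sqrt (1 - z\<^sup>2)) ^ 3)) \<partial>(lborel :: (real \<times> real) measure)) = K * indicator B z"
    proof (cases "z \<in> B")
      case True
      then have "z \<in> {-s..s}" using B by blast
      then have "\<bar>z\<bar> < 1" using s by auto
      then have z: "1 - z\<^sup>2 > 0" by (simp add: abs_square_less_1)
      define q where "q = sqrt (1 - z\<^sup>2)"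
      have q: "q > 0" "q\<^sup>2 = 1 - z\<^sup>2" using z by (auto simp: q_def)
      have "norm y < q \<longleftrightarrow> (norm y)\<^sup>2 + z\<^sup>2 < 1" for y :: "real \<times> real"
        using real_sqrt_less_iff[of "(norm y)\<^sup>2" "1 - z\<^sup>2"] by (auto simp: q_def)
      then have "(\<integral>\<^sup>+y. ennreal (indicator B z * indicator {..<1} ((norm y)\<^sup>2 + z\<^sup>2) * 
          (norm y / (sqrt (1 - z\<^sup>2)) ^ 3)) \<partial>(lborel :: (real \<times> real) measure)) =
          (\<integral>\<^sup>+y. ennreal (1 / q ^ 3) * ennreal (indicator {..<q} (norm y) * norm y) \<partial>(lborel :: (real \<times> real) measure))"
        using True q by (intro nn_integral_cong) (auto simp: q_def[symmetric] indicator_def ennreal_mult[symmetric])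
      also have "\<dots> = ennreal (1 / q ^ 3) * (ennreal (q ^ 3) * K)"
        unfolding K_def nn_integral_norm_disc[OF q(1), symmetric] by (rule nn_integral_cmult) auto
      also have "\<dots> = K"
        using q by (simp add: mult.assoc[symmetric] ennreal_mult[symmetric])
      finally show ?thesis using True by simp
    qed simp
  qed
  also have "\<dots> = K * emeasure lborel B"
    by (subst nn_integral_cmult) auto
  finally show ?thesis by (simp add: mult.assoc)
qed

text \<open>
  The slabs exhaust the sphere up to the two poles, which are null because the points projecting to them lie
  on a hyperplane. The constant is then read off from the total mass \<open>4 * pi\<close>.
\<close>

lemma emeasure_zone:
  fixes B :: "real set"
  assumes B: "B \<in> sets borel"
  shows "emeasure sphere_measure {m \<in> sphere 0 1. m $ 3 \<in> B} = ennreal (2 * pi) * emeasure lborel (B \<inter> {-1<..<1})"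
proof -
  define c where "c = 3 * (\<integral>\<^sup>+y. ennreal (indicator {..<1} (norm y) * norm y) \<partial>(lborel :: (real \<times> real) measure))"
  have m3 [measurable]: "(\<lambda>x :: real^3. x $ 3) \<in> borel_measurable borel"
    by (intro borel_measurable_continuous_onI continuous_intros)
  have zone: "{m \<in> sphere 0 1. m $ 3 \<in> B} \<in> sets sphere_measure"
    if "B \<in> sets borel" for B
    unfolding sets_sphere_measure by (subst sets_restrict_space_iff) (use that in \<open>auto\<close>, use that in measurable)
  define s :: "nat \<Rightarrow> real" where "s k = 1 - 1 / real (Suc k)" for k
  have s: "0 \<le> s k" "s k < 1" for k by (auto simp: s_def)
  have UN: "(\<Union>k. {-s k..s k}) = {-1<..<1}"
  proof (intro equalityI subsetI)
    fix z :: real assume "z \<in> {-1<..<1}"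
    then have "0 < 1 - \<bar>z\<bar>" by auto
    then obtain k where "1 / real (Suc k) < 1 - \<bar>z\<bar>" using nat_approx_posE by blast
    then have "z \<in> {-s k..s k}" by (auto simp: s_def)
    then show "z \<in> (\<Union>k. {-s k..s k})" by blast
  next
    fix z assume "z \<in> (\<Union>k. {-s k..s k})"
    then obtain k where "z \<in> {-s k..s k}" by blast
    then show "z \<in> {-1<..<1}" using s(2)[of k] by auto
  qed
  have mono: "s i \<le> s j" if "i \<le> j" for i j
    using that by (auto simp: s_def field_simps)
  have inner: "emeasure sphere_measure {m \<in> sphere 0 1. m $ 3 \<in> B \<inter> {-1<..<1}} = c * emeasure lborel (B \<inter> {-1<..<1})"
    if B: "B \<in> sets borel" for B
  proof -
    let ?Z = "\<lambda>k. {m \<in> sphere (0 :: real^3) 1. m $ 3 \<in> B \<inter> {-s k..s k}}"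
    have inc: "incseq (\<lambda>k. B \<inter> {-s k..s k})"
      using mono by (fastforce simp: incseq_def)
    then have incZ: "incseq ?Z" by (fastforce simp: incseq_def)
    have Z: "?Z k \<in> sets sphere_measure" for k
      using B by (intro zone) auto
    have "emeasure sphere_measure {m \<in> sphere 0 1. m $ 3 \<in> B \<inter> {-1<..<1}} = emeasure sphere_measure (\<Union>k. ?Z k)"
      unfolding UN[symmetric] by (rule arg_cong[where f = "emeasure sphere_measure"]) auto
    also have "\<dots> = (SUP k. emeasure sphere_measure (?Z k))"
      by (rule SUP_emeasure_incseq[symmetric]) (use incZ Z in blast)+
    also have "\<dots> = (SUP k. c * emeasure lborel (B \<inter> {-s k..s k}))"
      unfolding c_def using B by (intro SUP_cong refl emeasure_zone_slab[OF s(1) s(2)]) auto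
    also have "\<dots> = c * (SUP k. emeasure lborel (B \<inter> {-s k..s k}))"
      by (rule SUP_mult_left_ennreal[symmetric])
    also have "(SUP k. emeasure lborel (B \<inter> {-s k..s k})) = emeasure lborel (\<Union>k. B \<inter> {-s k..s k})"
      by (rule SUP_emeasure_incseq) (use inc B in auto)
    also have "(\<Union>k. B \<inter> {-s k..s k}) = B \<inter> {-1<..<1}" unfolding UN[symmetric] by blast
    finally show ?thesis .
  qed
  have null: "emeasure sphere_measure {m \<in> sphere 0 1. m $ 3 \<in> - {-1<..<1}} = 0"
  proof -
    have "emeasure sphere_measure {m \<in> sphere 0 1. m $ 3 \<in> - {-1<..<1}} = 
      3 * emeasure lborel {x \<in> ball 0 1 - {0}. sgn x \<in> {m \<in> sphere (0 :: real^3) 1. m $ 3 \<in> - {-1<..<1}}}"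
      by (rule emeasure_sphere_measure[OF zone[unfolded sets_sphere_measure]]) auto
    also have "emeasure lborel {x \<in> ball 0 1 - {0}. sgn x \<in> {m \<in> sphere (0 :: real^3) 1. m $ 3 \<in> - {-1<..<1}}} = 0"
    proof (rule emeasure_eq_0)
      have "negligible {x :: real^3. x $ 1 = 0}"
        by (rule negligible_standard_hyperplane_cart)
      moreover have "{x :: real^3. x $ 1 = 0} \<in> sets borel"
        by (intro borel_closed closed_Collect_eq continuous_intros)
      ultimately show "{x :: real^3. x $ 1 = 0} \<in> sets lborel" "emeasure lborel {x :: real^3. x $ 1 = 0} = 0"
        by (auto simp: negligible_iff_null_sets null_sets_def)
      show "{x \<in> ball 0 1 - {0}. sgn x \<in> {m \<in> sphere (0 :: real^3) 1. m $ 3 \<in> - {-1<..<1}}} \<subseteq> {x :: real^3. x $ 1 = 0}"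
      proof (intro subsetI CollectI)
        fix x :: "real^3" 
        assume "x \<in> {x \<in> ball 0 1 - {0}. sgn x \<in> {m \<in> sphere (0 :: real^3) 1. m $ 3 \<in> - {-1<..<1}}}"
        then have x: "x \<noteq> 0" "\<not> (sgn x) $ 3 \<in> {-1<..<1}" "sgn x \<in> sphere 0 1" by auto
        let ?m = "sgn x"
        have "(?m $ 1)\<^sup>2 + (?m $ 2)\<^sup>2 + (?m $ 3)\<^sup>2 = (norm ?m)\<^sup>2"
          by (simp add: norm_vec_def L2_set_def sum_3)
        also have "\<dots> = 1" using x(3) by simp
        finally have eq: "(?m $ 1)\<^sup>2 + (?m $ 2)\<^sup>2 + (?m $ 3)\<^sup>2 = 1" .
        have "\<bar>?m $ 3\<bar> \<ge> 1" using x(2) by auto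
        then have "(?m $ 3)\<^sup>2 \<ge> 1" by (simp add: one_le_power abs_le_square_iff[of 1, simplified])
        then have "(?m $ 1)\<^sup>2 \<le> 0" using eq zero_le_power2[of "?m $ 2"] by linarith
        then show "x $ 1 = 0" using x(1) by (simp add: sgn_div_norm)
      qed
    qed
    finally show ?thesis by simp
  qed
  have full: "emeasure sphere_measure {m \<in> sphere 0 1. m $ 3 \<in> B} = c * emeasure lborel (B \<inter> {-1<..<1})"
    if B: "B \<in> sets borel" for B
  proof -
    have "emeasure sphere_measure {m \<in> sphere 0 1. m $ 3 \<in> B} =
      emeasure sphere_measure ({m \<in> sphere 0 1. m $ 3 \<in> B \<inter> {-1<..<1}} \<union> {m \<in> sphere 0 1. m $ 3 \<in> B - {-1<..<1}})"
      by (rule arg_cong[where f = "emeasure sphere_measure"]) auto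
    also have "\<dots> = emeasure sphere_measure {m \<in> sphere 0 1. m $ 3 \<in> B \<inter> {-1<..<1}}"
    proof (rule emeasure_Un_null_set)
      show "{m \<in> sphere 0 1. m $ 3 \<in> B - {-1<..<1}} \<in> null_sets sphere_measure"
      proof (rule null_setsI)
        show "emeasure sphere_measure {m \<in> sphere 0 1. m $ 3 \<in> B - {-1<..<1}} = 0"
          by (rule emeasure_eq_0[OF zone null]) auto
      qed (intro zone, use B in auto)
    qed (intro zone, use B in auto)
    finally show ?thesis using inner[OF B] by simp
  qed
  have "c = ennreal (2 * pi)"
  proof -
    have "{m \<in> sphere (0 :: real^3) 1. m $ 3 \<in> UNIV} = sphere 0 1" by auto
    then have eq: "c * ennreal 2 = ennreal (4 * pi)"
      using full[of UNIV] emeasure_sphere_measure_space by simp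
    then have "c \<noteq> top" by (auto simp: ennreal_top_mult)
    then obtain r where r: "c = ennreal r" "r \<ge> 0" by (cases c) auto
    then have "ennreal (r * 2) = ennreal (4 * pi)" using eq by (simp add: ennreal_mult)
    then have "r * 2 = 4 * pi" using r by (subst (asm) ennreal_inj) auto
    then show ?thesis using r by simp
  qed
  then show ?thesis using full[OF B] by simp
qed

lemma distr_inner_sphere_measure:
  assumes e: "norm e = 1"
  shows "distr sphere_measure borel (\<lambda>m. m \<bullet> e) = density lborel (\<lambda>z. ennreal (2 * pi * indicator {-1<..<1} z))"
proof (rule measure_eqI)
  obtain R :: "real^3 \<Rightarrow> real^3" where R: "orthogonal_transformation R" "R e = axis 3 1"
    using orthogonal_transformation_exists_1[OF e, of "axis 3 1"] by auto
  have "(R m) \<bullet> (R e) = m \<bullet> e" for m using R(1) by (simp add: orthogonal_transformation_def)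
  then have Re: "m \<bullet> e = R m $ 3" for m using R(2) by (metis inner_axis inner_real_def mult.right_neutral real_inner_1_right)
  have [measurable]: "(\<lambda>x :: real^3. x $ 3) \<in> borel_measurable borel"
    by (intro borel_measurable_continuous_onI continuous_intros)
  have m3: "(\<lambda>x :: real^3. x $ 3) \<in> borel_measurable sphere_measure"
    unfolding measurable_cong_sets[OF sets_sphere_measure refl] by (rule measurable_restrict_space1) measurable
  note Rm = measurable_orthogonal_sphere_measure[OF R(1)]
  fix B assume "B \<in> sets (distr sphere_measure borel (\<lambda>m. m \<bullet> e))"
  then have B: "B \<in> sets borel" by simp
  have "distr sphere_measure borel (\<lambda>m. m \<bullet> e) = distr (distr sphere_measure sphere_measure R) borel (\<lambda>m. m $ 3)"
    by (subst distr_distr[OF m3 Rm]) (simp add: comp_def Re)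
  also have "\<dots> = distr sphere_measure borel (\<lambda>m. m $ 3)"
    by (simp add: sphere_measure_orthogonal_transformation[OF R(1)])
  also have "emeasure \<dots> B = emeasure sphere_measure {m \<in> sphere 0 1. m $ 3 \<in> B}"
    using B m3 by (simp add: emeasure_distr space_sphere_measure vimage_def Int_def conj_commute)
  also have "\<dots> = ennreal (2 * pi) * emeasure lborel (B \<inter> {-1<..<1})"
    by (rule emeasure_zone[OF B])
  also have "\<dots> = (\<integral>\<^sup>+z. ennreal (2 * pi) * indicator (B \<inter> {-1<..<1}) z \<partial>lborel)"
    using B by (subst nn_integral_cmult) auto
  also have "\<dots> = emeasure (density lborel (\<lambda>z. ennreal (2 * pi * indicator {-1<..<1} z))) B"
    using B by (subst emeasure_density) (auto intro!: nn_integral_cong simp: indicator_def)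
  finally show "emeasure (distr sphere_measure borel (\<lambda>m. m \<bullet> e)) B = 
    emeasure (density lborel (\<lambda>z. ennreal (2 * pi * indicator {-1<..<1} z))) B" .
qed simp

lemma sphere_integral_zonal:
  fixes F :: "real \<Rightarrow> real"
  assumes e: "norm e = 1" and F: "F \<in> borel_measurable borel"
  shows "(LINT m|sphere_measure. F (m \<bullet> e)) = 2 * pi * (LINT z:{-1<..<1}|lborel. F z)"
proof -
  have [measurable]: "(\<lambda>m. m \<bullet> e) \<in> borel_measurable sphere_measure"
    unfolding measurable_cong_sets[OF sets_sphere_measure refl] by (rule measurable_restrict_space1) measurable
  have "(LINT m|sphere_measure. F (m \<bullet> e)) = (LINT z|distr sphere_measure borel (\<lambda>m. m \<bullet> e). F z)"
    by (rule integral_distr[symmetric]) (use F in auto)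
  also have "\<dots> = (LINT z|lborel. 2 * pi * (indicator {-1<..<1} z * F z))"
    unfolding distr_inner_sphere_measure[OF e] 
    by (subst integral_density) (use F in \<open>auto simp: mult.assoc\<close>)
  also have "\<dots> = 2 * pi * (LINT z:{-1<..<1}|lborel. F z)"
    by (subst integral_mult_right_zero) (simp add: set_lebesgue_integral_def)
  finally show ?thesis .
qed

section \<open>Second moments of an axisymmetric weight\<close>

lemma measurable_sphere_continuous:
  fixes f :: "real^3 \<Rightarrow> real"
  assumes "continuous_on (sphere 0 1) f"
  shows "f \<in> borel_measurable sphere_measure"
  unfolding measurable_cong_sets[OF sets_sphere_measure refl]
  by (rule borel_measurable_continuous_on_restrict[OF assms])

lemma integrable_sphere_continuous:
  fixes f :: "real^3 \<Rightarrow> real"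
  assumes f: "continuous_on (sphere 0 1) f"
  shows "integrable sphere_measure f"
proof -
  interpret finite_measure sphere_measure by (rule finite_sphere_measure)
  have "compact (f ` sphere 0 1)"
    using f by (intro compact_continuous_image) auto
  then obtain C where C: "\<And>m. m \<in> sphere 0 1 \<Longrightarrow> norm (f m) \<le> C"
    using compact_imp_bounded bounded_iff by (metis image_eqI)
  show ?thesis
    by (rule integrable_const_bound[where B = C])
       (use C measurable_sphere_continuous[OF f] in \<open>auto intro!: AE_I2 simp: space_sphere_measure\<close>)
qed

lemma orthogonal_transformation_reflection:
  fixes w :: "real^'n"
  shows "orthogonal_transformation (\<lambda>v. v - (2 * (w \<bullet> v) / (w \<bullet> w)) *\<^sub>R w)"
  unfolding orthogonal_transformation_def
proof
  show "linear (\<lambda>v. v - (2 * (w \<bullet> v) / (w \<bullet> w)) *\<^sub>R w)"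
    by (rule linearI) (simp_all add: algebra_simps inner_add_right add_divide_distrib)
  show "\<forall>u v. (u - (2 * (w \<bullet> u) / (w \<bullet> w)) *\<^sub>R w) \<bullet> (v - (2 * (w \<bullet> v) / (w \<bullet> w)) *\<^sub>R w) = u \<bullet> v"
    by (cases "w = 0") (auto simp: inner_diff_left inner_diff_right inner_commute field_simps)
qed

text \<open>
  The reflection along \<open>x\<close> fixes the axis and changes the sign of the integrand.
\<close>

lemma sphere_integral_zonal_odd:
  fixes W :: "real \<Rightarrow> real"
  assumes W: "continuous_on UNIV W" and x: "x \<bullet> e = 0"
  shows "(LINT m|sphere_measure. (x \<bullet> m) * W (m \<bullet> e)) = 0"
proof -
  define R where "R v = v - (2 * (x \<bullet> v) / (x \<bullet> x)) *\<^sub>R x" for v :: "real^3"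
  have R: "orthogonal_transformation R" unfolding R_def by (rule orthogonal_transformation_reflection)
  have "(LINT m|sphere_measure. (x \<bullet> m) * W (m \<bullet> e)) = (LINT m|sphere_measure. (x \<bullet> R m) * W (R m \<bullet> e))"
    by (rule sphere_integral_orthogonal_transformation[OF R, symmetric])
       (intro measurable_sphere_continuous continuous_intros continuous_on_compose2[OF W], auto)
  also have "\<dots> = (LINT m|sphere_measure. - ((x \<bullet> m) * W (m \<bullet> e)))"
  proof (rule Bochner_Integration.integral_cong[OF refl])
    fix m
    have "x \<bullet> R m = - (x \<bullet> m)" by (cases "x = 0") (auto simp: R_def inner_diff_right)
    moreover have "R m \<bullet> e = m \<bullet> e" using x by (simp add: R_def inner_diff_left)
    ultimately show "(x \<bullet> R m) * W (R m \<bullet> e) = - ((x \<bullet> m) * W (m \<bullet> e))" by simp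
  qed
  finally show ?thesis by simp
qed

text \<open>
  The squared triple product as a Gram determinant. For orthonormal \<open>e\<close> and \<open>x\<close> it is Parseval's identity
  in the frame \<open>e\<close>, \<open>x\<close>, \<open>cross3 e x\<close>.
\<close>

lemma inner_cross3_power2:
  fixes m e x :: "real^3"
  shows "(m \<bullet> cross3 e x)\<^sup>2 = (m \<bullet> m) * (e \<bullet> e) * (x \<bullet> x) + 2 * (m \<bullet> e) * (e \<bullet> x) * (m \<bullet> x)
    - (m \<bullet> m) * (e \<bullet> x)\<^sup>2 - (e \<bullet> e) * (m \<bullet> x)\<^sup>2 - (x \<bullet> x) * (m \<bullet> e)\<^sup>2"
  by (simp add: cross3_def inner_vec_def sum_3 vector_def power2_eq_square algebra_simps)

text \<open>
  A reflection fixing the axis exchanges \<open>x\<close> with \<open>cross3 e x\<close>, so both directions contribute equally, and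
  by Parseval they add up to \<open>(norm x)\<^sup>2 * (1 - (m \<bullet> e)\<^sup>2)\<close>.
\<close>

lemma sphere_integral_zonal_square:
  fixes W :: "real \<Rightarrow> real"
  assumes W: "continuous_on UNIV W" and x: "x \<bullet> e = 0" and e: "norm e = 1"
  shows "(LINT m|sphere_measure. (x \<bullet> m)\<^sup>2 * W (m \<bullet> e)) = 
    (norm x)\<^sup>2 * (LINT m|sphere_measure. (1 - (m \<bullet> e)\<^sup>2) * W (m \<bullet> e)) / 2"
proof -
  define y where "y = cross3 e x"
  define w where "w = x - y"
  define R where "R v = v - (2 * (w \<bullet> v) / (w \<bullet> w)) *\<^sub>R w" for v :: "real^3"
  have R: "orthogonal_transformation R" unfolding R_def by (rule orthogonal_transformation_reflection)
  have y: "y \<bullet> e = 0" "x \<bullet> y = 0" "y \<bullet> y = x \<bullet> x"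
  proof -
    show "y \<bullet> e = 0" "x \<bullet> y = 0" by (simp_all add: y_def dot_cross_self)
    have "(norm y)\<^sup>2 = (norm x)\<^sup>2"
      using norm_cross_dot[of e x] x e by (simp add: y_def inner_commute)
    then show "y \<bullet> y = x \<bullet> x" by (simp add: power2_norm_eq_inner)
  qed
  have we: "w \<bullet> e = 0" using x y by (simp add: w_def inner_diff_left)
  have ww: "w \<bullet> w = 2 * (x \<bullet> x)" using y by (simp add: w_def inner_diff_left inner_diff_right inner_commute)
  have cont: "continuous_on S (\<lambda>m. W (m \<bullet> e))" for S
    by (intro continuous_on_compose2[OF W]) (auto intro!: continuous_intros)
  have int: "integrable sphere_measure (\<lambda>m. (v \<bullet> m)\<^sup>2 * W (m \<bullet> e))" for v
    by (intro integrable_sphere_continuous continuous_intros cont)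
  have "(LINT m|sphere_measure. (x \<bullet> m)\<^sup>2 * W (m \<bullet> e)) = (LINT m|sphere_measure. (x \<bullet> R m)\<^sup>2 * W (R m \<bullet> e))"
    by (rule sphere_integral_orthogonal_transformation[OF R, symmetric])
       (intro measurable_sphere_continuous continuous_intros cont)
  also have "\<dots> = (LINT m|sphere_measure. (y \<bullet> m)\<^sup>2 * W (m \<bullet> e))"
  proof (rule Bochner_Integration.integral_cong[OF refl])
    fix m
    have "R m \<bullet> e = m \<bullet> e" using we by (simp add: R_def inner_diff_left)
    moreover have "x \<bullet> R m = y \<bullet> m"
    proof (cases "x = 0")
      case True then show ?thesis by (simp add: y_def)
    next
      case False
      have "x \<bullet> w = x \<bullet> x" using y by (simp add: w_def inner_diff_right)
      then have "x \<bullet> R m = x \<bullet> m - w \<bullet> m" using False by (simp add: R_def inner_diff_right ww)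
      then show ?thesis by (simp add: w_def inner_diff_left)
    qed
    ultimately show "(x \<bullet> R m)\<^sup>2 * W (R m \<bullet> e) = (y \<bullet> m)\<^sup>2 * W (m \<bullet> e)" by simp
  qed
  finally have eq: "(LINT m|sphere_measure. (x \<bullet> m)\<^sup>2 * W (m \<bullet> e)) = (LINT m|sphere_measure. (y \<bullet> m)\<^sup>2 * W (m \<bullet> e))" .
  have "(LINT m|sphere_measure. (x \<bullet> m)\<^sup>2 * W (m \<bullet> e)) + (LINT m|sphere_measure. (y \<bullet> m)\<^sup>2 * W (m \<bullet> e))
    = (LINT m|sphere_measure. (x \<bullet> m)\<^sup>2 * W (m \<bullet> e) + (y \<bullet> m)\<^sup>2 * W (m \<bullet> e))"
    by (rule Bochner_Integration.integral_add[symmetric]) (rule int)+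
  also have "\<dots> = (LINT m|sphere_measure. (norm x)\<^sup>2 * ((1 - (m \<bullet> e)\<^sup>2) * W (m \<bullet> e)))"
  proof (rule Bochner_Integration.integral_cong[OF refl])
    fix m assume "m \<in> space sphere_measure"
    then have m: "m \<bullet> m = 1" by (simp add: space_sphere_measure dot_square_norm)
    have "(y \<bullet> m)\<^sup>2 = (x \<bullet> x) - (x \<bullet> m)\<^sup>2 - (x \<bullet> x) * (m \<bullet> e)\<^sup>2"
      using inner_cross3_power2[of m e x] m x e by (simp add: y_def inner_commute dot_square_norm)
    then have "(x \<bullet> m)\<^sup>2 + (y \<bullet> m)\<^sup>2 = (norm x)\<^sup>2 * (1 - (m \<bullet> e)\<^sup>2)"
      by (simp add: power2_norm_eq_inner algebra_simps)
    then show "(x \<bullet> m)\<^sup>2 * W (m \<bullet> e) + (y \<bullet> m)\<^sup>2 * W (m \<bullet> e) = (norm x)\<^sup>2 * ((1 - (m \<bullet> e)\<^sup>2) * W (m \<bullet> e))"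
      by (metis distrib_right mult.assoc)
  qed
  also have "\<dots> = (norm x)\<^sup>2 * (LINT m|sphere_measure. (1 - (m \<bullet> e)\<^sup>2) * W (m \<bullet> e))" by simp
  finally show ?thesis using eq by simp
qed

section \<open>Moments of the equilibrium density\<close>

lemma weight_integrable:
  fixes f :: "real \<Rightarrow> real"
  assumes "continuous_on UNIV f"
  shows "(\<lambda>z. f z * exp (\<eta> * z\<^sup>2)) integrable_on {-1..1}"
  by (intro integrable_continuous_real continuous_intros continuous_on_subset[OF assms]) auto

lemma A_0_pos: "A 0 \<eta> > 0"
proof -
  have "exp (- \<bar>\<eta>\<bar>) * 2 = integral {-1..1} (\<lambda>z :: real. exp (- \<bar>\<eta>\<bar>))" by simp
  also have "\<dots> \<le> A 0 \<eta>"
    unfolding A_def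
  proof (rule integral_le)
    show "(\<lambda>z. z ^ 0 * exp (\<eta> * z\<^sup>2)) integrable_on {-1..1}"
      by (rule weight_integrable) (auto intro!: continuous_intros)
    fix z :: real assume "z \<in> {-1..1}"
    then have "z\<^sup>2 \<le> 1" by (simp add: abs_square_le_1 abs_le_iff)
    then have "\<bar>\<eta>\<bar> * z\<^sup>2 \<le> \<bar>\<eta>\<bar>" by (simp add: mult_left_le)
    then have "\<bar>\<eta> * z\<^sup>2\<bar> \<le> \<bar>\<eta>\<bar>" by (simp add: abs_mult)
    then have "- \<bar>\<eta>\<bar> \<le> \<eta> * z\<^sup>2" by linarith
    then show "exp (- \<bar>\<eta>\<bar>) \<le> z ^ 0 * exp (\<eta> * z\<^sup>2)" by simp
  qed auto
  finally show ?thesis by (smt (verit) exp_gt_zero)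
qed

lemma A_4_le_A_2: "A 4 \<eta> \<le> A 2 \<eta>"
  unfolding A_def
proof (intro integral_le weight_integrable continuous_intros)
  fix z :: real assume "z \<in> {-1..1}"
  then have "z\<^sup>2 \<le> 1" by (simp add: abs_square_le_1 abs_le_iff)
  then have "z\<^sup>2 * z\<^sup>2 \<le> z\<^sup>2 * 1" by (intro mult_left_mono) auto
  then have "z ^ 4 \<le> z\<^sup>2" by (simp add: power4_eq_xxxx power2_eq_square mult.assoc)
  then show "z ^ 4 * exp (\<eta> * z\<^sup>2) \<le> z\<^sup>2 * exp (\<eta> * z\<^sup>2)" by simp
qed

lemma A_2_le_A_0: "A 2 \<eta> \<le> A 0 \<eta>"
  unfolding A_def
proof (intro integral_le weight_integrable continuous_intros)
  fix z :: real assume "z \<in> {-1..1}"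
  then have "z\<^sup>2 \<le> 1" by (simp add: abs_square_le_1 abs_le_iff)
  then show "z\<^sup>2 * exp (\<eta> * z\<^sup>2) \<le> z ^ 0 * exp (\<eta> * z\<^sup>2)" by simp
qed

lemma integral_even_polynomial:
  "integral {-1..1} (\<lambda>z. (p + q * z\<^sup>2 + r * z ^ 4) * exp (\<eta> * z\<^sup>2)) = p * A 0 \<eta> + q * A 2 \<eta> + r * A 4 \<eta>"
proof -
  have *: "((\<lambda>z. z ^ k * exp (\<eta> * z\<^sup>2)) has_integral A k \<eta>) {-1..1}" for k
    unfolding A_def by (intro integrable_integral weight_integrable continuous_intros)
  have "((\<lambda>z. p * (z ^ 0 * exp (\<eta> * z\<^sup>2)) + q * (z\<^sup>2 * exp (\<eta> * z\<^sup>2)) + r * (z ^ 4 * exp (\<eta> * z\<^sup>2)))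
    has_integral p * A 0 \<eta> + q * A 2 \<eta> + r * A 4 \<eta>) {-1..1}"
    by (intro has_integral_add has_integral_mult_right *)
  then show ?thesis by (simp add: algebra_simps integral_unique)
qed

text \<open>
  Integration by parts: the derivative of \<open>(z - z ^ 3) * exp (\<eta> * z\<^sup>2)\<close> integrates to 0, since \<open>z - z ^ 3\<close>
  vanishes at \<open>\<plusminus>1\<close>.
\<close>

lemma A_parts: "3 * A 2 \<eta> - A 0 \<eta> = 2 * \<eta> * (A 2 \<eta> - A 4 \<eta>)"
proof -
  have "((\<lambda>z. (1 + (2 * \<eta> - 3) * z\<^sup>2 + (- 2 * \<eta>) * z ^ 4) * exp (\<eta> * z\<^sup>2)) has_integral
      ((1 - 1 ^ 3) * exp (\<eta> * 1\<^sup>2) - ((- 1) - (- 1) ^ 3) * exp (\<eta> * (- 1)\<^sup>2))) {-1..1}"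
    by (rule fundamental_theorem_of_calculus)
       (auto intro!: derivative_eq_intros simp: has_real_derivative_iff_has_vector_derivative[symmetric] algebra_simps eval_nat_numeral)
  then have "integral {-1..1} (\<lambda>z. (1 + (2 * \<eta> - 3) * z\<^sup>2 + (- 2 * \<eta>) * z ^ 4) * exp (\<eta> * z\<^sup>2)) = 0"
    by (simp add: integral_unique)
  then show ?thesis unfolding integral_even_polynomial by (simp add: algebra_simps)
qed

text \<open>
  This is the weighted integral of the energy density \<open>\<phi>'\<^sup>2 + \<phi>\<^sup>2 / sin\<^sup>2\<close> of \<open>\<phi> \<theta> = sin \<theta> * cos \<theta>\<close>, written in
  \<open>z = cos \<theta>\<close>. It is bounded below through
  \<open>1 - 3 * z\<^sup>2 + 4 * z ^ 4 = 7 / 16 + (2 * z\<^sup>2 - 3 / 4)\<^sup>2\<close>.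
\<close>

lemma A_energy_pos: "0 < A 0 \<eta> - 3 * A 2 \<eta> + 4 * A 4 \<eta>"
proof -
  have "0 \<le> integral {-1..1} (\<lambda>z. (9 / 16 + (- 3) * z\<^sup>2 + 4 * z ^ 4) * exp (\<eta> * z\<^sup>2))"
  proof (intro integral_nonneg weight_integrable continuous_intros)
    fix z :: real
    have "9 / 16 + (- 3) * z\<^sup>2 + 4 * z ^ 4 = (2 * z\<^sup>2 - 3 / 4)\<^sup>2"
      by (simp add: power2_eq_square power4_eq_xxxx algebra_simps)
    then show "0 \<le> (9 / 16 + (- 3) * z\<^sup>2 + 4 * z ^ 4) * exp (\<eta> * z\<^sup>2)" by simp
  qed
  then have "0 \<le> 9 / 16 * A 0 \<eta> + (- 3) * A 2 \<eta> + 4 * A 4 \<eta>"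
    unfolding integral_even_polynomial .
  then show ?thesis using A_0_pos[of \<eta>] by linarith
qed

lemma set_integral_continuous:
  fixes F :: "real \<Rightarrow> real"
  assumes "continuous_on UNIV F"
  shows "(LINT z:{-1<..<1}|lborel. F z) = integral {-1..1} F"
proof -
  have "set_integrable lborel {-1..1} F"
    by (rule borel_integrable_atLeastAtMost') (rule continuous_on_subset[OF assms], auto)
  then have "set_integrable lborel {-1<..<1} F"
    by (rule set_integrable_subset) auto
  then have "(LINT z:{-1<..<1}|lborel. F z) = integral {-1<..<1} F"
    by (rule set_borel_integral_eq_integral)
  then show ?thesis by (simp add: integral_open_interval_real)
qed

lemma h_eq:
  assumes e: "norm e = 1"
  shows "h \<eta> e m = exp (\<eta> * (m \<bullet> e)\<^sup>2) / (2 * pi * A 0 \<eta>)"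
proof -
  have "(LINT m|sphere_measure. exp (\<eta> * (m \<bullet> e)\<^sup>2)) = 2 * pi * A 0 \<eta>"
    by (subst sphere_integral_zonal[OF e, of "\<lambda>z. exp (\<eta> * z\<^sup>2)"], measurable,
        subst set_integral_continuous) (auto simp: A_def intro!: continuous_intros)
  then show ?thesis by (simp add: h_def)
qed

lemma avg_zonal:
  fixes F :: "real \<Rightarrow> real"
  assumes e: "norm e = 1" and F: "F \<in> borel_measurable borel"
  shows "avg (h \<eta> e) (\<lambda>m. F (m \<bullet> e)) = (LINT z:{-1<..<1}|lborel. F z * exp (\<eta> * z\<^sup>2)) / A 0 \<eta>"
proof -
  note [measurable] = F
  have "avg (h \<eta> e) (\<lambda>m. F (m \<bullet> e)) = 2 * pi * (LINT z:{-1<..<1}|lborel. F z * exp (\<eta> * z\<^sup>2) / (2 * pi * A 0 \<eta>))"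
    unfolding avg_def h_eq[OF e] times_divide_eq_right
    by (rule sphere_integral_zonal[OF e]) measurable
  also have "\<dots> = (LINT z:{-1<..<1}|lborel. F z * exp (\<eta> * z\<^sup>2)) / A 0 \<eta>"
    by simp
  finally show ?thesis .
qed

lemma avg_zonal_continuous:
  fixes F :: "real \<Rightarrow> real"
  assumes e: "norm e = 1" and F: "continuous_on UNIV F"
  shows "avg (h \<eta> e) (\<lambda>m. F (m \<bullet> e)) = integral {-1..1} (\<lambda>z. F z * exp (\<eta> * z\<^sup>2)) / A 0 \<eta>"
  using F by (subst avg_zonal[OF e borel_measurable_continuous_onI[OF F]], subst set_integral_continuous)
     (auto intro!: continuous_intros)

lemma avg_even_polynomial:
  assumes e: "norm e = 1"
  shows "avg (h \<eta> e) (\<lambda>m. p + q * (m \<bullet> e)\<^sup>2 + r * (m \<bullet> e) ^ 4) = p + q * (A 2 \<eta> / A 0 \<eta>) + r * (A 4 \<eta> / A 0 \<eta>)"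
proof -
  have "continuous_on UNIV (\<lambda>z :: real. p + q * z\<^sup>2 + r * z ^ 4)" by (intro continuous_intros)
  from avg_zonal_continuous[OF e this] show ?thesis
    unfolding integral_even_polynomial using A_0_pos[of \<eta>] by (simp add: add_divide_distrib)
qed

lemma order_param_2:
  assumes e: "norm e = 1"
  shows "order_param 2 \<eta> e = (3 * (A 2 \<eta> / A 0 \<eta>) - 1) / 2"
proof -
  have "legendre 2 x = - 1 / 2 + 3 / 2 * x\<^sup>2 + 0 * x ^ 4" for x
    by (simp add: eval_nat_numeral field_simps)
  then show ?thesis unfolding order_param_def by (simp only: avg_even_polynomial[OF e]) simp
qed

lemma order_param_4:
  assumes e: "norm e = 1"
  shows "order_param 4 \<eta> e = (35 * (A 4 \<eta> / A 0 \<eta>) - 30 * (A 2 \<eta> / A 0 \<eta>) + 3) / 8"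
proof -
  have "legendre 4 x = 3 / 8 + (- 30 / 8) * x\<^sup>2 + 35 / 8 * x ^ 4" for x
    by (simp add: eval_nat_numeral field_simps)
  then show ?thesis unfolding order_param_def by (simp only: avg_even_polynomial[OF e]) simp
qed

text \<open>
  On unit vectors \<open>|m \<times> m'|\<^sup>2 = 1 - (m \<bullet> m')\<^sup>2\<close>. Splitting \<open>m\<close> into its component along \<open>e\<close> and a part \<open>x\<close>
  orthogonal to \<open>e\<close> reduces the potential to the second moments of the density: the mixed one vanishes and the
  one along \<open>x\<close> is half of what the axis leaves over.
\<close>

lemma U_h:
  fixes m e :: "real^3" and \<alpha> \<eta> :: real
  assumes e: "norm e = 1" and m: "norm m = 1"
  defines "a \<equiv> A 2 \<eta> / A 0 \<eta>"
  shows "U \<alpha> (h \<eta> e) m = \<alpha> * (1 + a) / 2 - \<alpha> * (3 * a - 1) / 2 * (m \<bullet> e)\<^sup>2"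
proof -
  define W where "W z = exp (\<eta> * z\<^sup>2) / (2 * pi * A 0 \<eta>)" for z
  have W: "continuous_on UNIV W" unfolding W_def using A_0_pos[of \<eta>] by (auto intro!: continuous_intros)
  have hW: "h \<eta> e m' = W (m' \<bullet> e)" for m' by (simp add: h_eq[OF e] W_def)
  have cont: "continuous_on S (\<lambda>m. W (m \<bullet> e))" for S
    by (intro continuous_on_compose2[OF W]) (auto intro!: continuous_intros)
  define z where "z = m \<bullet> e"
  define x where "x = m - z *\<^sub>R e"
  have ee: "e \<bullet> e = 1" using e by (simp add: dot_square_norm)
  have xe: "x \<bullet> e = 0" by (simp add: x_def z_def inner_diff_left ee)
  have "m \<bullet> m = 1" using m by (simp add: dot_square_norm)
  then have "x \<bullet> x = 1 - z\<^sup>2"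
    by (simp add: x_def inner_diff_left inner_diff_right ee inner_commute[of e m] z_def[symmetric] power2_eq_square)
  then have xx: "(norm x)\<^sup>2 = 1 - z\<^sup>2" unfolding power2_norm_eq_inner .
  have mass: "(LINT m|sphere_measure. W (m \<bullet> e)) = 1"
    using avg_even_polynomial[OF e, of \<eta> 1 0 0] by (simp add: avg_def hW)
  have second: "(LINT m|sphere_measure. (m \<bullet> e)\<^sup>2 * W (m \<bullet> e)) = a"
    using avg_even_polynomial[OF e, of \<eta> 0 1 0] by (simp add: avg_def hW a_def)
  have second': "(LINT m|sphere_measure. (1 - (m \<bullet> e)\<^sup>2) * W (m \<bullet> e)) = 1 - a"
    using avg_even_polynomial[OF e, of \<eta> 1 "-1" 0] by (simp add: avg_def hW a_def)
  have "(LINT m'|sphere_measure. (norm (cross3 m m'))\<^sup>2 * h \<eta> e m') =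
    (LINT m'|sphere_measure. W (m' \<bullet> e) - z\<^sup>2 * ((m' \<bullet> e)\<^sup>2 * W (m' \<bullet> e))
       - 2 * z * ((x \<bullet> m') * ((m' \<bullet> e) * W (m' \<bullet> e))) - (x \<bullet> m')\<^sup>2 * W (m' \<bullet> e))"
  proof (rule Bochner_Integration.integral_cong[OF refl])
    fix m' assume "m' \<in> space sphere_measure"
    then have "norm m' = 1" by (simp add: space_sphere_measure)
    then have "(norm (cross3 m m'))\<^sup>2 = 1 - (m \<bullet> m')\<^sup>2"
      using norm_cross_dot[of m m'] m by simp
    moreover have "m \<bullet> m' = z * (m' \<bullet> e) + x \<bullet> m'"
      by (simp add: x_def inner_diff_left inner_commute[of m' e])
    ultimately show "(norm (cross3 m m'))\<^sup>2 * h \<eta> e m' = W (m' \<bullet> e) - z\<^sup>2 * ((m' \<bullet> e)\<^sup>2 * W (m' \<bullet> e))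
       - 2 * z * ((x \<bullet> m') * ((m' \<bullet> e) * W (m' \<bullet> e))) - (x \<bullet> m')\<^sup>2 * W (m' \<bullet> e)"
      by (simp add: hW) (simp add: power2_eq_square algebra_simps)
  qed
  also have "\<dots> = 1 - z\<^sup>2 * a - 2 * z * 0 - (1 - z\<^sup>2) * (1 - a) / 2"
  proof -
    have 1: "(LINT m'|sphere_measure. (x \<bullet> m') * ((m' \<bullet> e) * W (m' \<bullet> e))) = 0"
      by (rule sphere_integral_zonal_odd[OF _ xe, of "\<lambda>z. z * W z"]) (intro continuous_intros W)
    have 2: "(LINT m'|sphere_measure. (x \<bullet> m')\<^sup>2 * W (m' \<bullet> e)) = (1 - z\<^sup>2) * (1 - a) / 2"
      using sphere_integral_zonal_square[OF W xe e] by (simp only: xx second')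
    have [simp]: "integrable sphere_measure (\<lambda>m'. W (m' \<bullet> e))" "integrable sphere_measure (\<lambda>m'. (m' \<bullet> e)\<^sup>2 * W (m' \<bullet> e))"
      "integrable sphere_measure (\<lambda>m'. (x \<bullet> m') * ((m' \<bullet> e) * W (m' \<bullet> e)))" "integrable sphere_measure (\<lambda>m'. (x \<bullet> m')\<^sup>2 * W (m' \<bullet> e))"
      by (intro integrable_sphere_continuous continuous_intros cont)+
    show ?thesis
      by (simp add: mass second 1 2)
  qed
  finally have eq: "(LINT m'|sphere_measure. (norm (cross3 m m'))\<^sup>2 * h \<eta> e m') =
    1 - z\<^sup>2 * a - 2 * z * 0 - (1 - z\<^sup>2) * (1 - a) / 2" .
  show ?thesis
    unfolding U_def eq z_def[symmetric] by (simp add: field_simps)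
qed

lemma is_potential_eq:
  fixes e :: "real^3" and \<alpha> \<eta> :: real
  assumes e: "norm e = 1" and u: "is_potential \<alpha> \<eta> e u" and \<theta>: "\<theta> \<in> {0..pi}"
  defines "a \<equiv> A 2 \<eta> / A 0 \<eta>"
  shows "u \<theta> = \<alpha> * (1 + a) / 2 - \<alpha> * (3 * a - 1) / 2 * (cos \<theta>)\<^sup>2"
proof -
  obtain R :: "real^3 \<Rightarrow> real^3" where R: "orthogonal_transformation R" "R (axis 1 1) = e"
    using orthogonal_transformation_exists_1[of "axis 1 1 :: real^3" e] e by auto
  define x where "x = R (axis 2 1)"
  have xe: "x \<bullet> e = 0" "x \<bullet> x = 1"
    using R(1) unfolding x_def R(2)[symmetric] by (simp_all add: orthogonal_transformation_def inner_axis_axis)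
  have ee: "e \<bullet> e = 1" using e by (simp add: dot_square_norm)
  define m where "m = cos \<theta> *\<^sub>R e + sin \<theta> *\<^sub>R x"
  have me: "m \<bullet> e = cos \<theta>" using xe ee by (simp add: m_def inner_add_left)
  have "m \<bullet> m = 1" using xe ee
    by (simp add: m_def inner_add_left inner_add_right inner_commute[of e x] power2_eq_square[symmetric])
  then have "norm m = 1" by (simp add: norm_eq_sqrt_inner)
  moreover from this have "u (arccos (m \<bullet> e)) = U \<alpha> (h \<eta> e) m"
    using u unfolding is_potential_def by blast
  ultimately show ?thesis
    using U_h[OF e, of m \<alpha> \<eta>] \<theta> by (simp add: me arccos_cos a_def)
qed

section \<open>Excluding singular behaviour at an endpoint\<close>

text \<open>
  Under these hypotheses \<open>f x + c * ln x\<close> is nonincreasing, so \<open>f\<close> grows at least like \<open>- c * ln x\<close> as \<open>x\<close> tends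
  to 0.
\<close>

lemma unbounded_of_deriv_le:
  fixes f f' :: "real \<Rightarrow> real"
  assumes r: "r > 0" and c: "c > 0"
    and der: "\<And>x. x \<in> {0<..<r} \<Longrightarrow> (f has_real_derivative f' x) (at x)"
    and le: "\<And>x. x \<in> {0<..<r} \<Longrightarrow> x * f' x \<le> - c"
  shows "\<not> bounded (f ` {0<..<r})"
proof
  assume "bounded (f ` {0<..<r})"
  then obtain M where M: "\<And>x. x \<in> {0<..<r} \<Longrightarrow> \<bar>f x\<bar> \<le> M"
    unfolding bounded_iff by (metis image_eqI real_norm_def)
  define b where "b = r / 2"
  have b: "b \<in> {0<..<r}" using r by (simp add: b_def)
  have M0: "M \<ge> 0" using M[OF b] by linarith
  \<comment> \<open>At this point the logarithm has gained more than the oscillation \<open>2 * M\<close> that the bound permits.\<close>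
  define a where "a = b * exp (- ((2 * M + 1) / c))"
  have "exp (- ((2 * M + 1) / c)) < 1" using M0 c by (simp add: field_simps)
  then have ab: "0 < a" "a < b" using b by (auto simp: a_def)
  have "f b + c * ln b \<le> f a + c * ln a"
  proof (rule DERIV_nonpos_imp_nonincreasing[of a b "\<lambda>x. f x + c * ln x"])
    fix x assume "a \<le> x" "x \<le> b"
    then have x: "x \<in> {0<..<r}" using ab b by auto
    have "((\<lambda>x. f x + c * ln x) has_real_derivative f' x + c * (1 / x)) (at x)"
      using x by (auto intro!: derivative_eq_intros der)
    moreover have "f' x + c * (1 / x) \<le> 0"
      using le[OF x] x by (simp add: field_simps)
    ultimately show "\<exists>y. ((\<lambda>x. f x + c * ln x) has_real_derivative y) (at x) \<and> y \<le> 0" by blast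
  qed (use ab in simp)
  moreover have "ln a = ln b - (2 * M + 1) / c"
    using b by (simp add: a_def ln_mult)
  moreover have "f a \<le> M" "- M \<le> f b" 
    using M[of a] M[of b] ab b by auto
  ultimately show False using c by (simp add: right_diff_distrib)
qed

text \<open>
  The form used for boundary terms: a flux \<open>p * f'\<close> with a weight vanishing linearly at 0 cannot
  stay below a negative constant if \<open>f\<close> is bounded, even if it is perturbed
  by a term \<open>q\<close> that vanishes linearly as well: close to 0 that term is at most \<open>d / 2\<close>.
\<close>

lemma unbounded_of_weighted_deriv_le:
  fixes f f' p q :: "real \<Rightarrow> real"
  assumes r: "r > 0" and d: "d > 0" and C: "C > 0"
    and der: "\<And>x. x \<in> {0<..<r} \<Longrightarrow> (f has_real_derivative f' x) (at x)"
    and p: "\<And>x. x \<in> {0<..<r} \<Longrightarrow> 0 < p x \<and> p x \<le> C * x"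
    and q: "\<And>x. x \<in> {0<..<r} \<Longrightarrow> \<bar>q x\<bar> \<le> C * x"
    and le: "\<And>x. x \<in> {0<..<r} \<Longrightarrow> p x * f' x + q x \<le> - d"
  shows "\<not> bounded (f ` {0<..<r})"
proof -
  define s where "s = min r (d / (2 * C))"
  have s: "s > 0" "s \<le> r" "s \<le> d / (2 * C)" using r d C by (auto simp: s_def)
  have "\<not> bounded (f ` {0<..<s})"
  proof (rule unbounded_of_deriv_le[OF s(1)])
    show "d / (2 * C) > 0" using d C by simp
    fix x assume x: "x \<in> {0<..<s}"
    then have xr: "x \<in> {0<..<r}" using s by auto
    show "(f has_real_derivative f' x) (at x)" by (rule der[OF xr])
    have "C * x \<le> C * (d / (2 * C))" using x s(3) C by (intro mult_left_mono) auto
    then have "C * x \<le> d / 2" using C by simp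
    then have pf: "p x * f' x \<le> - (d / 2)" using le[OF xr] q[OF xr] by linarith
    have f0: "f' x \<le> 0"
    proof (rule ccontr)
      assume "\<not> f' x \<le> 0"
      then have "p x * f' x > 0" using p[OF xr] by simp
      then show False using pf d by linarith
    qed
    have "C * x * f' x \<le> p x * f' x" using p[OF xr] f0 by (simp add: mult_right_mono_neg)
    then show "x * f' x \<le> - (d / (2 * C))" using pf C by (simp add: field_simps)
  qed
  then show ?thesis using s(2) by (meson bounded_subset image_mono greaterThanLessThan_subseteq_greaterThanLessThan order_refl)
qed

section \<open>The variational bound for the equation of the angular profile\<close>

text \<open>
  The self-consistency relation for \<open>\<eta>\<close> gives the potential this explicit form: the coefficient of
  \<open>(cos \<theta>)\<^sup>2\<close> is the exponent of the density itself.
\<close>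

locale leslie_problem =
  fixes \<eta> C0 :: real and u g :: "real \<Rightarrow> real"
  assumes u: "\<And>\<theta>. \<theta> \<in> {0..pi} \<Longrightarrow> u \<theta> = C0 - \<eta> * (cos \<theta>)\<^sup>2"
    and g: "is_bounded_solution u g"
begin

lemma deriv_u:
  assumes "\<theta> \<in> {0<..<pi}"
  shows "deriv u \<theta> = 2 * \<eta> * sin \<theta> * cos \<theta>"
proof (rule DERIV_imp_deriv)
  have "((\<lambda>\<theta>. C0 - \<eta> * (cos \<theta>)\<^sup>2) has_real_derivative 2 * \<eta> * sin \<theta> * cos \<theta>) (at \<theta>)"
    by (auto intro!: derivative_eq_intros)
  then show "(u has_real_derivative 2 * \<eta> * sin \<theta> * cos \<theta>) (at \<theta>)"
    by (rule has_field_derivative_transform_within_open[of _ _ _ "{0<..<pi}"])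
       (use assms u in auto)
qed

lemma g_deriv:
  assumes "\<theta> \<in> {0<..<pi}"
  shows "(g has_real_derivative deriv g \<theta>) (at \<theta>)"
  using g assms by (auto simp: is_bounded_solution_def DERIV_deriv_iff_real_differentiable)

text \<open>
  The equation in divergence form, with \<open>exp (- u)\<close> (up to a constant factor) as integrating factor.
\<close>

lemma flux_deriv:
  assumes \<theta>: "\<theta> \<in> {0<..<pi}"
  shows "((\<lambda>t. sin t * deriv g t * exp (\<eta> * (cos t)\<^sup>2)) has_real_derivative
    (g \<theta> / sin \<theta> - 2 * \<eta> * (sin \<theta>)\<^sup>2 * cos \<theta>) * exp (\<eta> * (cos \<theta>)\<^sup>2)) (at \<theta>)"
proof -
  define s where "s = sin \<theta>"
  define D where "D = deriv (\<lambda>t. sin t * deriv g t) \<theta>"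
  have s: "s > 0" using \<theta> by (simp add: s_def sin_gt_zero)
  have "(\<lambda>t. sin t * deriv g t) differentiable (at \<theta>)"
    using g \<theta> by (auto simp: is_bounded_solution_def)
  then have D: "((\<lambda>t. sin t * deriv g t) has_real_derivative D) (at \<theta>)"
    by (simp add: D_def DERIV_deriv_iff_real_differentiable)
  have "1 / s * D - g \<theta> / s\<^sup>2 - 2 * \<eta> * s * cos \<theta> * deriv g \<theta> = - (2 * \<eta> * s * cos \<theta>)"
    using g \<theta> unfolding is_bounded_solution_def s_def D_def deriv_u[OF \<theta>, symmetric] by blast
  then have "s * (1 / s * D - g \<theta> / s\<^sup>2 - 2 * \<eta> * s * cos \<theta> * deriv g \<theta>) = s * (- (2 * \<eta> * s * cos \<theta>))"
    by simp
  moreover have "s * (1 / s * D - g \<theta> / s\<^sup>2 - 2 * \<eta> * s * cos \<theta> * deriv g \<theta>) = 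
      D - g \<theta> / s - 2 * \<eta> * s\<^sup>2 * cos \<theta> * deriv g \<theta>"
    using s by (simp add: field_simps power2_eq_square)
  ultimately have D': "D = g \<theta> / s - 2 * \<eta> * s\<^sup>2 * cos \<theta> + 2 * \<eta> * s\<^sup>2 * cos \<theta> * deriv g \<theta>"
    by (simp add: power2_eq_square mult_ac)
  have "((\<lambda>t. sin t * deriv g t * exp (\<eta> * (cos t)\<^sup>2)) has_real_derivative
      D * exp (\<eta> * (cos \<theta>)\<^sup>2) + s * deriv g \<theta> * (exp (\<eta> * (cos \<theta>)\<^sup>2) * (\<eta> * (2 * cos \<theta> * - s)))) (at \<theta>)"
  proof -
    have "((\<lambda>t. exp (\<eta> * (cos t)\<^sup>2)) has_real_derivative exp (\<eta> * (cos \<theta>)\<^sup>2) * (\<eta> * (2 * cos \<theta> * - s))) (at \<theta>)"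
      unfolding s_def by (auto intro!: derivative_eq_intros)
    from DERIV_mult'[OF D this] show ?thesis by (simp add: s_def algebra_simps)
  qed
  moreover have "D * exp (\<eta> * (cos \<theta>)\<^sup>2) + s * deriv g \<theta> * (exp (\<eta> * (cos \<theta>)\<^sup>2) * (\<eta> * (2 * cos \<theta> * - s))) =
    (g \<theta> / s - 2 * \<eta> * s\<^sup>2 * cos \<theta>) * exp (\<eta> * (cos \<theta>)\<^sup>2)"
    unfolding D' by (simp add: algebra_simps power2_eq_square)
  ultimately show ?thesis unfolding s_def by simp
qed

text \<open>
  Put \<open>\<phi> \<theta> = sin \<theta> * cos \<theta>\<close> and write \<open>z = cos \<theta>\<close>. Then this is the density, with respect to \<open>dz\<close>, of
  \<open>u' g - 2 c u' \<phi> + c\<^sup>2 (\<phi>'\<^sup>2 + \<phi>\<^sup>2 / sin\<^sup>2)\<close> weighted by \<open>exp (\<eta> * z\<^sup>2)\<close>. If \<open>u' g\<close> is replaced by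
  \<open>g'\<^sup>2 + g\<^sup>2 / sin\<^sup>2\<close> and \<open>u' \<phi>\<close> by \<open>g' \<phi>' + g \<phi> / sin\<^sup>2\<close>, as the weak form of the equation allows, it becomes
  the Dirichlet energy density of \<open>g - c \<phi>\<close>.
\<close>

definition energy_gap :: "real \<Rightarrow> real \<Rightarrow> real" where
  "energy_gap c z = (g (arccos z) * (2 * \<eta> * sqrt (1 - z\<^sup>2) * z) - 4 * c * \<eta> * (z\<^sup>2 * (1 - z\<^sup>2))
     + c\<^sup>2 * (1 - 3 * z\<^sup>2 + 4 * z ^ 4)) * exp (\<eta> * z\<^sup>2)"

lemma g_arccos_continuous: "continuous_on {-1<..<1} (\<lambda>z. g (arccos z))"
proof (rule continuous_on_compose2[where g = g and f = arccos and t = "{0<..<pi}"])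
  show "continuous_on {0<..<pi} g"
    using g_deriv by (meson DERIV_isCont continuous_at_imp_continuous_on)
  show "continuous_on {-1<..<1} arccos"
    by (rule continuous_on_subset[OF continuous_on_arccos']) auto
  show "arccos ` {- 1<..<1} \<subseteq> {0<..<pi}" by (auto simp: arccos_lt_bounded)
qed

lemma energy_gap_continuous: "continuous_on {-1<..<1} (energy_gap c)"
  unfolding energy_gap_def by (intro continuous_intros g_arccos_continuous)

lemma energy_gap_integrable: "set_integrable lborel {-1<..<1} (energy_gap c)"
proof -
  obtain M where M: "\<And>\<theta>. \<theta> \<in> {0<..<pi} \<Longrightarrow> \<bar>g \<theta>\<bar> \<le> M"
    using g unfolding is_bounded_solution_def bounded_iff by (metis image_eqI real_norm_def)
  define P where "P z = 2 * \<eta> * sqrt (1 - z\<^sup>2) * z * exp (\<eta> * z\<^sup>2)" for z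
  define Q where "Q z = (c\<^sup>2 * (1 - 3 * z\<^sup>2 + 4 * z ^ 4) - 4 * c * \<eta> * (z\<^sup>2 * (1 - z\<^sup>2))) * exp (\<eta> * z\<^sup>2)" for z
  have cont: "set_integrable lborel {-1<..<1} f" if "continuous_on {-1..1} f" for f :: "real \<Rightarrow> real"
    by (rule set_integrable_subset[OF borel_integrable_atLeastAtMost'[OF that]]) auto
  have "set_integrable lborel {-1<..<1} (\<lambda>z. g (arccos z) * P z)"
  proof (rule set_integrable_bound)
    show "set_integrable lborel {-1<..<1} (\<lambda>z. M * P z)"
      unfolding P_def by (intro cont continuous_intros)
    have "continuous_on {-1<..<1} (\<lambda>z. g (arccos z) * P z)"
      unfolding P_def by (intro continuous_intros g_arccos_continuous)
    from borel_measurable_continuous_on_indicator[OF _ this]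
    show "set_borel_measurable lborel {-1<..<1} (\<lambda>z. g (arccos z) * P z)"
      by (simp add: set_borel_measurable_def)
    show "AE z in lborel. z \<in> {-1<..<1} \<longrightarrow> norm (g (arccos z) * P z) \<le> norm (M * P z)"
    proof (intro AE_I2 impI)
      fix z :: real assume "z \<in> {-1<..<1}"
      then have "\<bar>g (arccos z)\<bar> \<le> M" by (intro M) (auto simp: arccos_lt_bounded)
      then show "norm (g (arccos z) * P z) \<le> norm (M * P z)"
        by (auto simp: abs_mult intro!: mult_right_mono)
    qed
  qed
  moreover have "set_integrable lborel {-1<..<1} Q"
    unfolding Q_def by (intro cont continuous_intros)
  ultimately have "set_integrable lborel {-1<..<1} (\<lambda>z. g (arccos z) * P z + Q z)"
    by (rule set_integral_add(1))
  also have "(\<lambda>z. g (arccos z) * P z + Q z) = energy_gap c"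
    by (rule ext) (simp add: P_def Q_def energy_gap_def algebra_simps)
  finally show ?thesis .
qed

text \<open>
  With \<open>S = sin \<theta>\<close>, \<open>k = cos \<theta>\<close>, \<open>G = g \<theta>\<close> and \<open>G' = deriv g \<theta>\<close>: the derivative of the boundary term
  plus \<open>sin \<theta>\<close> times the energy gap, both divided by the weight, is \<open>sin \<theta>\<close> times the Dirichlet energy density of
  \<open>g - c \<phi>\<close>, hence nonnegative.
\<close>

lemma energy_identity:
  fixes S k G G' c :: real
  assumes "S > 0" "S\<^sup>2 + k\<^sup>2 = 1"
  shows "(G / S - 2 * \<eta> * S\<^sup>2 * k) * (G - 2 * c * (S * k)) + S * G' * (G' - 2 * c * (k\<^sup>2 - S\<^sup>2))
    + S * (G * (2 * \<eta> * S * k) - 4 * c * \<eta> * (k\<^sup>2 * S\<^sup>2) + c\<^sup>2 * (1 - 3 * k\<^sup>2 + 4 * k ^ 4))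
    = S * (G' - c * (k\<^sup>2 - S\<^sup>2))\<^sup>2 + (G - c * (S * k))\<^sup>2 / S"
proof -
  have "1 - 3 * k\<^sup>2 + 4 * k ^ 4 = (k\<^sup>2 - (1 - k\<^sup>2))\<^sup>2 + k\<^sup>2"
    by (simp add: power2_eq_square power4_eq_xxxx algebra_simps)
  also have "1 - k\<^sup>2 = S\<^sup>2" using assms(2) by simp
  finally have *: "1 - 3 * k\<^sup>2 + 4 * k ^ 4 = (k\<^sup>2 - S\<^sup>2)\<^sup>2 + k\<^sup>2" .
  show ?thesis
    unfolding * using assms(1) by (simp add: field_simps power2_eq_square)
qed

text \<open>
  The integral equals the Dirichlet energy of \<open>g - c \<phi>\<close> up to boundary terms at the poles. These are values of
  \<open>Y = sin * g' * exp (\<eta> * cos\<^sup>2) * v\<close> with \<open>v = g - 2 c \<phi>\<close>, and \<open>Y\<close> is, up to a bounded multiple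
  of \<open>sin\<close>, a weight vanishing like \<open>sin\<close> times the derivative of the bounded function \<open>v\<^sup>2\<close>. If the integral
  were negative, monotonicity of \<open>Y\<close> minus the running integral would force \<open>Y\<close> to stay below \<open>- d\<close> near 0 or
  above \<open>d\<close> near \<open>pi\<close>, and then \<open>v\<^sup>2\<close> would grow logarithmically there. Using the single factor \<open>v\<close> treats the
  boundary terms of the energy of \<open>g\<close> and of the test with \<open>\<phi>\<close> at the same time.
\<close>

lemma integral_energy_gap_nonneg: "0 \<le> (LINT z:{-1<..<1}|lborel. energy_gap c z)"
proof (rule ccontr)
  assume neg: "\<not> ?thesis"
  define E where "E \<theta> = exp (\<eta> * (cos \<theta>)\<^sup>2)" for \<theta>
  define v where "v \<theta> = g \<theta> - 2 * c * (sin \<theta> * cos \<theta>)" for \<theta>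
  define v' where "v' \<theta> = deriv g \<theta> - 2 * c * ((cos \<theta>)\<^sup>2 - (sin \<theta>)\<^sup>2)" for \<theta>
  define Y where "Y \<theta> = sin \<theta> * deriv g \<theta> * E \<theta> * v \<theta>" for \<theta>
  define J where "J z = integral {-1..z} (energy_gap c)" for z
  have "energy_gap c integrable_on {-1<..<1}" "(LINT z:{-1<..<1}|lborel. energy_gap c z) = integral {-1<..<1} (energy_gap c)"
    using set_borel_integral_eq_integral[OF energy_gap_integrable] by auto
  then have int: "energy_gap c integrable_on {-1..1}" and LJ: "(LINT z:{-1<..<1}|lborel. energy_gap c z) = J 1"
    by (simp_all add: J_def integrable_on_open_interval_real integral_open_interval_real)
  \<comment> \<open>A quarter: \<open>J\<close> may move by \<open>d\<close> at each pole, and \<open>2 * d\<close> remains to be shared by the two boundary terms.\<close>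
  define d where "d = - J 1 / 4"
  have d: "d > 0" using neg LJ by (simp add: d_def)
  have J0: "J (- 1) = 0" by (simp add: J_def)
  have J_der: "(J has_real_derivative energy_gap c z) (at z)" if z: "z \<in> {-1<..<1}" for z
  proof -
    have "isCont (energy_gap c) z"
      using energy_gap_continuous z by (simp add: continuous_on_eq_continuous_at)
    then have "(J has_vector_derivative energy_gap c z) (at z within {-1..1} - {})"
      unfolding J_def
      by (intro integral_has_vector_derivative_continuous_at[OF int]) (use z continuous_at_imp_continuous_within in auto)
    moreover have "at z within {-1..1} = at z"
      using z by (intro at_within_interior) simp
    ultimately show ?thesis by (simp add: has_real_derivative_iff_has_vector_derivative)
  qed
  have v_der: "(v has_real_derivative v' \<theta>) (at \<theta>)" if "\<theta> \<in> {0<..<pi}" for \<theta>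
    unfolding v_def v'_def by (auto intro!: derivative_eq_intros g_deriv[OF that] simp: power2_eq_square)
  have mono: "Y a - J (cos a) \<le> Y b - J (cos b)" if ab: "0 < a" "a \<le> b" "b < pi" for a b
  proof (rule DERIV_nonneg_imp_nondecreasing[OF ab(2)])
    fix \<theta> assume "a \<le> \<theta>" "\<theta> \<le> b"
    then have \<theta>: "\<theta> \<in> {0<..<pi}" using ab by auto
    define S where "S = sin \<theta>"
    define k where "k = cos \<theta>"
    have S: "S > 0" using \<theta> by (simp add: S_def sin_gt_zero)
    have Sk: "S\<^sup>2 + k\<^sup>2 = 1" by (simp add: S_def k_def)
    then have "k\<^sup>2 < 1" using S by (smt (verit) zero_less_power2)
    then have k: "k \<in> {-1<..<1}" by (auto simp: abs_square_less_1 abs_less_iff)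
    have "sqrt (1 - k\<^sup>2) = S" using S Sk by (smt (verit) real_sqrt_abs)
    moreover have "1 - k\<^sup>2 = S\<^sup>2" using Sk by simp
    moreover have "arccos k = \<theta>" using \<theta> by (simp add: k_def arccos_cos)
    ultimately have gap: "energy_gap c k = (g \<theta> * (2 * \<eta> * S * k) - 4 * c * \<eta> * (k\<^sup>2 * S\<^sup>2) + c\<^sup>2 * (1 - 3 * k\<^sup>2 + 4 * k ^ 4)) * E \<theta>"
      by (simp add: energy_gap_def E_def k_def[symmetric])
    have Y_der: "(Y has_real_derivative (S * deriv g \<theta> * E \<theta>) * v' \<theta> + ((g \<theta> / S - 2 * \<eta> * S\<^sup>2 * k) * E \<theta>) * v \<theta>) (at \<theta>)"
      unfolding Y_def S_def k_def E_def by (rule DERIV_mult'[OF flux_deriv[OF \<theta>] v_der[OF \<theta>]])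
    have "(cos has_real_derivative - S) (at \<theta>)" unfolding S_def by (rule DERIV_cos)
    from DERIV_chain2[OF J_der[OF k, unfolded k_def] this]
    have "((\<lambda>\<theta>. Y \<theta> - J (cos \<theta>)) has_real_derivative
        ((S * deriv g \<theta> * E \<theta>) * v' \<theta> + ((g \<theta> / S - 2 * \<eta> * S\<^sup>2 * k) * E \<theta>) * v \<theta>) - energy_gap c k * - S) (at \<theta>)"
      unfolding k_def[symmetric] by (intro DERIV_diff Y_der)
    moreover have "((S * deriv g \<theta> * E \<theta>) * v' \<theta> + ((g \<theta> / S - 2 * \<eta> * S\<^sup>2 * k) * E \<theta>) * v \<theta>) - energy_gap c k * - S
      = E \<theta> * ((g \<theta> / S - 2 * \<eta> * S\<^sup>2 * k) * v \<theta> + S * deriv g \<theta> * v' \<theta> + 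
         S * (g \<theta> * (2 * \<eta> * S * k) - 4 * c * \<eta> * (k\<^sup>2 * S\<^sup>2) + c\<^sup>2 * (1 - 3 * k\<^sup>2 + 4 * k ^ 4)))"
      unfolding gap by (simp add: algebra_simps)
    also have "\<dots> = E \<theta> * (S * (deriv g \<theta> - c * (k\<^sup>2 - S\<^sup>2))\<^sup>2 + (g \<theta> - c * (S * k))\<^sup>2 / S)"
      unfolding v_def v'_def S_def[symmetric] k_def[symmetric] by (subst energy_identity[OF S Sk]) simp
    moreover have "\<dots> \<ge> 0"
      using S by (simp add: E_def)
    ultimately show "\<exists>y. ((\<lambda>\<theta>. Y \<theta> - J (cos \<theta>)) has_real_derivative y) (at \<theta>) \<and> 0 \<le> y" by auto
  qed
  have Jcos: "continuous_on {0..pi} (\<lambda>\<theta>. J (cos \<theta>))"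
  proof (rule continuous_on_compose2[where g = J and f = cos and t = "{-1..1}"])
    show "continuous_on {-1..1} J"
      unfolding J_def by (rule indefinite_integral_continuous_1[OF int])
  qed (auto intro!: continuous_intros)
  obtain r1 where r1: "r1 > 0" "\<And>\<theta>. \<theta> \<in> {0..pi} \<Longrightarrow> \<bar>\<theta>\<bar> < r1 \<Longrightarrow> \<bar>J (cos \<theta>) - J 1\<bar> < d"
    using Jcos[unfolded continuous_on_iff, rule_format, of 0 d] d by (auto simp: dist_real_def)
  obtain r2 where r2: "r2 > 0" "\<And>\<theta>. \<theta> \<in> {0..pi} \<Longrightarrow> \<bar>\<theta> - pi\<bar> < r2 \<Longrightarrow> \<bar>J (cos \<theta>)\<bar> < d"
    using Jcos[unfolded continuous_on_iff, rule_format, of pi d] d by (auto simp: dist_real_def J0)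
  define r where "r = min (min r1 r2) (pi / 2)"
  have r: "r > 0" "r \<le> r1" "r \<le> r2" "r \<le> pi / 2" using r1(1) r2(1) by (auto simp: r_def)
  have Y_gap: "2 * d < Y (pi - b) - Y a" if "a \<in> {0<..<r}" "b \<in> {0<..<r}" for a b
  proof -
    have "\<bar>J (cos a) - J 1\<bar> < d" "\<bar>J (cos (pi - b))\<bar> < d"
      using that r by (auto intro!: r1(2) r2(2) simp del: cos_pi_minus)
    moreover have "Y a - J (cos a) \<le> Y (pi - b) - J (cos (pi - b))"
      using that r by (intro mono) auto
    moreover have "J 1 = - 4 * d" by (simp add: d_def)
    ultimately show ?thesis by linarith
  qed
  obtain M where M: "\<And>\<theta>. \<theta> \<in> {0<..<pi} \<Longrightarrow> \<bar>g \<theta>\<bar> \<le> M"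
    using g unfolding is_bounded_solution_def bounded_iff by (metis image_eqI real_norm_def)
  define N where "N = M + 2 * \<bar>c\<bar>"
  have v_bound: "\<bar>v \<theta>\<bar> \<le> N" if "\<theta> \<in> {0<..<pi}" for \<theta>
  proof -
    have "\<bar>2 * c * (sin \<theta> * cos \<theta>)\<bar> \<le> 2 * \<bar>c\<bar>"
      by (simp add: abs_mult mult_left_le mult_le_one)
    then show ?thesis using M[OF that] unfolding v_def N_def by linarith
  qed
  have N: "N \<ge> 0" using v_bound[of "pi / 2"] by force
  define p where "p \<theta> = sin \<theta> * E \<theta> / 2" for \<theta>
  define q where "q \<theta> = 2 * c * ((cos \<theta>)\<^sup>2 - (sin \<theta>)\<^sup>2) * (sin \<theta> * E \<theta>) * v \<theta>" for \<theta>
  have pq: "p \<theta> * (2 * v \<theta> * v' \<theta>) + q \<theta> = Y \<theta>" for \<theta>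
    by (simp add: p_def q_def Y_def v'_def algebra_simps)
  have f_der: "((\<lambda>\<theta>. (v \<theta>)\<^sup>2) has_real_derivative 2 * v \<theta> * v' \<theta>) (at \<theta>)" if "\<theta> \<in> {0<..<pi}" for \<theta>
    using v_der[OF that] by (auto intro!: derivative_eq_intros)
  have f_bounded: "bounded ((\<lambda>\<theta>. (v \<theta>)\<^sup>2) ` {0<..<pi})"
    unfolding bounded_iff using v_bound N by (intro exI[of _ "N\<^sup>2"]) (auto simp: abs_le_square_iff[symmetric])
  define C where "C = exp \<bar>\<eta>\<bar> * (1 + 2 * \<bar>c\<bar> * N)"
  have C: "C > 0" using N by (simp add: C_def add_pos_nonneg)
  have E_le: "E \<theta> \<le> exp \<bar>\<eta>\<bar>" for \<theta>
  proof -
    have "\<bar>\<eta> * (cos \<theta>)\<^sup>2\<bar> \<le> \<bar>\<eta>\<bar>" by (simp add: abs_mult mult_left_le abs_square_le_1)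
    then show ?thesis by (simp add: E_def)
  qed
  have p_bound: "0 < p \<theta> \<and> p \<theta> \<le> C * sin \<theta>" and q_bound: "\<bar>q \<theta>\<bar> \<le> C * sin \<theta>" if \<theta>: "\<theta> \<in> {0<..<pi}" for \<theta>
  proof -
    have s: "sin \<theta> > 0" using \<theta> by (simp add: sin_gt_zero)
    have sE: "0 < sin \<theta> * E \<theta>" "sin \<theta> * E \<theta> \<le> exp \<bar>\<eta>\<bar> * sin \<theta>" using s E_le[of \<theta>] by (auto simp: E_def)
    have C': "C * sin \<theta> = exp \<bar>\<eta>\<bar> * sin \<theta> + 2 * \<bar>c\<bar> * N * (exp \<bar>\<eta>\<bar> * sin \<theta>)"
      by (simp add: C_def algebra_simps)
    have pos: "0 \<le> 2 * \<bar>c\<bar> * N * (exp \<bar>\<eta>\<bar> * sin \<theta>)" "0 \<le> exp \<bar>\<eta>\<bar> * sin \<theta>" using N s by auto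
    show "0 < p \<theta> \<and> p \<theta> \<le> C * sin \<theta>" using sE pos unfolding p_def C' by linarith
    have "\<bar>(cos \<theta>)\<^sup>2 - (sin \<theta>)\<^sup>2\<bar> \<le> 1" by (metis cos_double abs_cos_le_one)
    have "\<bar>q \<theta>\<bar> = 2 * \<bar>c\<bar> * (\<bar>(cos \<theta>)\<^sup>2 - (sin \<theta>)\<^sup>2\<bar> * \<bar>v \<theta>\<bar>) * (sin \<theta> * E \<theta>)"
      using s by (simp add: q_def abs_mult E_def)
    also have "\<dots> \<le> 2 * \<bar>c\<bar> * (1 * N) * (exp \<bar>\<eta>\<bar> * sin \<theta>)"
    proof (rule mult_mono)
      show "2 * \<bar>c\<bar> * (\<bar>(cos \<theta>)\<^sup>2 - (sin \<theta>)\<^sup>2\<bar> * \<bar>v \<theta>\<bar>) \<le> 2 * \<bar>c\<bar> * (1 * N)"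
        using v_bound[OF \<theta>] \<open>\<bar>(cos \<theta>)\<^sup>2 - (sin \<theta>)\<^sup>2\<bar> \<le> 1\<close>
        by (intro mult_left_mono mult_mono) auto
    qed (use sE N in auto)
    also have "\<dots> \<le> C * sin \<theta>" using pos unfolding C' by simp
    finally show "\<bar>q \<theta>\<bar> \<le> C * sin \<theta>" .
  qed
  have sin_le: "C * sin x \<le> C * x" if "x > 0" for x
    using C that by (intro mult_left_mono sin_x_le_x) auto
  show False
  proof (cases "\<forall>\<theta>\<in>{0<..<r}. Y \<theta> \<le> - d")
    case True
    have "\<not> bounded ((\<lambda>\<theta>. (v \<theta>)\<^sup>2) ` {0<..<r})"
    proof (rule unbounded_of_weighted_deriv_le[OF r(1) d C])
      fix x assume x: "x \<in> {0<..<r}"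
      then have xpi: "x \<in> {0<..<pi}" using r(4) by auto
      show "((\<lambda>\<theta>. (v \<theta>)\<^sup>2) has_real_derivative 2 * v x * v' x) (at x)" by (rule f_der[OF xpi])
      show "0 < p x \<and> p x \<le> C * x" "\<bar>q x\<bar> \<le> C * x"
        using p_bound[OF xpi] q_bound[OF xpi] sin_le[of x] x by auto
      show "p x * (2 * v x * v' x) + q x \<le> - d" using True x by (simp only: pq)
    qed
    moreover have "{0<..<r} \<subseteq> {0<..<pi}" using r(4) by auto
    ultimately show False using f_bounded by (meson bounded_subset image_mono)
  next
    case False
    then obtain a where a: "a \<in> {0<..<r}" "Y a > - d" by auto
    have "\<not> bounded ((\<lambda>\<theta>. (v (pi - \<theta>))\<^sup>2) ` {0<..<r})"
    proof (rule unbounded_of_weighted_deriv_le[OF r(1) d C])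
      fix x assume x: "x \<in> {0<..<r}"
      then have xpi: "pi - x \<in> {0<..<pi}" using r(4) by auto
      have "((\<lambda>\<theta>. pi - \<theta>) has_real_derivative - 1) (at x)" by (auto intro!: derivative_eq_intros)
      from DERIV_chain2[OF f_der[OF xpi] this]
      show "((\<lambda>\<theta>. (v (pi - \<theta>))\<^sup>2) has_real_derivative - (2 * v (pi - x) * v' (pi - x))) (at x)" by simp
      show "0 < p (pi - x) \<and> p (pi - x) \<le> C * x" "\<bar>- q (pi - x)\<bar> \<le> C * x"
        using p_bound[OF xpi] q_bound[OF xpi] sin_le[of x] x by auto
      have "p (pi - x) * - (2 * v (pi - x) * v' (pi - x)) + - q (pi - x) = - Y (pi - x)"
        using pq[of "pi - x"] by linarith
      also have "\<dots> \<le> - d" using Y_gap[OF a(1) x] a(2) by linarith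
      finally show "p (pi - x) * - (2 * v (pi - x) * v' (pi - x)) + - q (pi - x) \<le> - d" .
    qed
    moreover have "(\<lambda>\<theta>. (v (pi - \<theta>))\<^sup>2) ` {0<..<r} \<subseteq> (\<lambda>\<theta>. (v \<theta>)\<^sup>2) ` {0<..<pi}"
      using r(4) by (auto intro!: image_eqI[of _ _ "pi - _"])
    ultimately show False using f_bounded by (meson bounded_subset)
  qed
qed

text \<open>
  For \<open>c = 0\<close> the energy gap reduces to the weighted product \<open>u' g\<close>.
\<close>

lemma avg_g_u:
  assumes e: "norm e = 1"
  shows "avg (h \<eta> e) (\<lambda>m. g (arccos (m \<bullet> e)) * deriv u (arccos (m \<bullet> e)))
    = (LINT z:{-1<..<1}|lborel. energy_gap 0 z) / A 0 \<eta>"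
proof -
  define G where "G z = g (arccos z) * deriv u (arccos z)" for z
  \<comment> \<open>At the poles \<open>deriv u\<close> is not determined by the hypotheses, so \<open>F\<close> takes over the
      values of the integrand there; a change on the two poles preserves measurability and the integral.\<close>
  define F where "F z = indicator {-1<..<1} z * (g (arccos z) * (2 * \<eta> * sqrt (1 - z\<^sup>2) * z))
    + (G 1 * indicator {1} z + G (- 1) * indicator {-1} z)" for z
  have "continuous_on {-1<..<1} (\<lambda>z. g (arccos z) * (2 * \<eta> * sqrt (1 - z\<^sup>2) * z))"
    by (intro continuous_intros g_arccos_continuous)
  from borel_measurable_continuous_on_indicator[OF _ this]
  have [measurable]: "(\<lambda>z. indicator {-1<..<1} z * (g (arccos z) * (2 * \<eta> * sqrt (1 - z\<^sup>2) * z))) \<in> borel_measurable borel"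
    by simp
  have F: "F \<in> borel_measurable borel" unfolding F_def by measurable
  have GF: "G z = F z" if "z \<in> {-1..1}" for z
  proof (cases "z \<in> {-1<..<1}")
    case True
    then have "arccos z \<in> {0<..<pi}" by (auto simp: arccos_lt_bounded)
    from deriv_u[OF this] show ?thesis
      using True by (simp add: G_def F_def sin_arccos)
  next
    case False
    then have "z = 1 \<or> z = - 1" using that by auto
    then show ?thesis by (auto simp: F_def)
  qed
  have "avg (h \<eta> e) (\<lambda>m. G (m \<bullet> e)) = avg (h \<eta> e) (\<lambda>m. F (m \<bullet> e))"
    unfolding avg_def
  proof (rule Bochner_Integration.integral_cong[OF refl])
    fix m assume "m \<in> space sphere_measure"
    then have "\<bar>m \<bullet> e\<bar> \<le> 1"
      using Cauchy_Schwarz_ineq2[of m e] e by (simp add: space_sphere_measure)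
    then show "G (m \<bullet> e) * h \<eta> e m = F (m \<bullet> e) * h \<eta> e m" by (subst GF) auto
  qed
  also have "\<dots> = (LINT z:{-1<..<1}|lborel. F z * exp (\<eta> * z\<^sup>2)) / A 0 \<eta>"
    by (rule avg_zonal[OF e F])
  also have "(LINT z:{-1<..<1}|lborel. F z * exp (\<eta> * z\<^sup>2)) = (LINT z:{-1<..<1}|lborel. energy_gap 0 z)"
    by (intro set_lebesgue_integral_cong) (auto simp: F_def energy_gap_def)
  finally show ?thesis by (simp add: G_def)
qed

text \<open>
  The averaged energy gap is a nonnegative quadratic polynomial in \<open>c\<close>, and its value at the minimiser is the claim. Its
  linear coefficient is \<open>- 2 \<langle>u' \<phi>\<rangle>\<close>, where \<open>\<langle>u' \<phi>\<rangle> = 2 \<eta> (a - b)\<close> equals \<open>3 a - 1\<close> by \<open>A_parts\<close>.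
\<close>

lemma dual_energy_bound:
  assumes e: "norm e = 1"
  defines "a \<equiv> A 2 \<eta> / A 0 \<eta>" and "b \<equiv> A 4 \<eta> / A 0 \<eta>"
  shows "(3 * a - 1)\<^sup>2 \<le> avg (h \<eta> e) (\<lambda>m. g (arccos (m \<bullet> e)) * deriv u (arccos (m \<bullet> e))) * (1 - 3 * a + 4 * b)"
proof -
  define G where "G = avg (h \<eta> e) (\<lambda>m. g (arccos (m \<bullet> e)) * deriv u (arccos (m \<bullet> e)))"
  define q where "q = 1 - 3 * a + 4 * b"
  note A0 = A_0_pos[of \<eta>]
  have parts: "3 * a - 1 = 2 * \<eta> * (a - b)"
    using A_parts[of \<eta>] A0 by (simp add: a_def b_def field_simps)
  have quad: "0 \<le> G - 2 * c * (3 * a - 1) + c\<^sup>2 * q" for c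
  proof -
    define Q where "Q z = (c\<^sup>2 + (- 3 * c\<^sup>2 - 4 * c * \<eta>) * z\<^sup>2 + (4 * c\<^sup>2 + 4 * c * \<eta>) * z ^ 4) * exp (\<eta> * z\<^sup>2)" for z
    have Q: "continuous_on UNIV Q" unfolding Q_def by (intro continuous_intros)
    have "set_integrable lborel {-1<..<1} Q"
      by (rule set_integrable_subset[OF borel_integrable_atLeastAtMost'[OF continuous_on_subset[OF Q], of "-1" 1]]) auto
    then have "(LINT z:{-1<..<1}|lborel. energy_gap 0 z + Q z) = 
        (LINT z:{-1<..<1}|lborel. energy_gap 0 z) + (LINT z:{-1<..<1}|lborel. Q z)"
      by (intro set_integral_add energy_gap_integrable)
    also have "(LINT z:{-1<..<1}|lborel. Q z) = c\<^sup>2 * A 0 \<eta> + (- 3 * c\<^sup>2 - 4 * c * \<eta>) * A 2 \<eta> + (4 * c\<^sup>2 + 4 * c * \<eta>) * A 4 \<eta>"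
      unfolding set_integral_continuous[OF Q] unfolding Q_def by (rule integral_even_polynomial)
    also have "(LINT z:{-1<..<1}|lborel. energy_gap 0 z) = G * A 0 \<eta>"
      using avg_g_u[OF e] A0 by (simp add: G_def)
    also have "(\<lambda>z. energy_gap 0 z + Q z) = energy_gap c"
      by (rule ext) (simp add: energy_gap_def Q_def algebra_simps flip: power_add)
    finally have "0 \<le> G * A 0 \<eta> + (c\<^sup>2 * A 0 \<eta> + (- 3 * c\<^sup>2 - 4 * c * \<eta>) * A 2 \<eta> + (4 * c\<^sup>2 + 4 * c * \<eta>) * A 4 \<eta>)"
      using integral_energy_gap_nonneg[of c] by simp
    also have "\<dots> = A 0 \<eta> * (G - 2 * c * (2 * \<eta> * (a - b)) + c\<^sup>2 * q)"
      using A0 by (simp add: q_def a_def b_def field_simps)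
    finally show ?thesis
      using A0 unfolding parts by (simp add: zero_le_mult_iff)
  qed
  have q: "q > 0"
    using A_energy_pos[of \<eta>] A0 by (simp add: q_def a_def b_def field_simps)
  have "0 \<le> G - 2 * ((3 * a - 1) / q) * (3 * a - 1) + ((3 * a - 1) / q)\<^sup>2 * q" by (rule quad)
  also have "\<dots> = G - (3 * a - 1)\<^sup>2 / q"
    using q by (simp add: field_simps power2_eq_square)
  finally have "(3 * a - 1)\<^sup>2 / q \<le> G" by simp
  then have "(3 * a - 1)\<^sup>2 \<le> G * q" using q by (simp add: divide_le_eq)
  then show ?thesis by (simp add: G_def q_def)
qed

end

section \<open>The quadratic form in the velocity gradient\<close>

text \<open>
  In an orthonormal basis starting with \<open>n\<close>, the left side collects the squares of the entries in the first row and column.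
  Without choosing a basis: the matrix \<open>M\<close> with entries \<open>D $ i $ j - v $ i * n $ j\<close> has squared norm
  \<open>ddot D D - v \<bullet> v\<close>, and applying its transpose to \<open>n\<close> gives \<open>v - x n\<close>; Cauchy-Schwarz in each column compares the two.
\<close>

lemma symmetric_form_lower_bound:
  fixes D :: "real^3^3" and n :: "real^3"
  assumes sym: "transpose D = D" and n: "norm n = 1"
  shows "2 * (norm (D *v n))\<^sup>2 - (n \<bullet> (D *v n))\<^sup>2 \<le> ddot D D"
proof -
  define v where "v = D *v n"
  define x where "x = n \<bullet> v"
  define M where "M j = (\<chi> i. D $ i $ j - v $ i * n $ j)" for j
  have D_sym: "D $ i $ j = D $ j $ i" for i j
    using arg_cong[OF sym, of "\<lambda>X. X $ i $ j"] by (simp add: transpose_def)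
  have nn: "n \<bullet> n = 1" using n by (simp add: norm_eq_1)
  have v: "(\<Sum>j\<in>UNIV. D $ i $ j * n $ j) = v $ i" for i
    by (simp add: v_def matrix_vector_mult_def)
  have nM: "n \<bullet> M j = v $ j - x * n $ j" for j
  proof -
    have "n \<bullet> M j = (\<Sum>i\<in>UNIV. D $ j $ i * n $ i) - (\<Sum>i\<in>UNIV. n $ i * v $ i) * n $ j"
      unfolding D_sym[of j]
      by (simp add: inner_vec_def M_def right_diff_distrib sum_subtractf sum_distrib_left mult_ac)
    then show ?thesis by (simp add: v x_def inner_vec_def)
  qed
  have "v \<bullet> v - x\<^sup>2 = (v - x *\<^sub>R n) \<bullet> (v - x *\<^sub>R n)"
    by (simp add: inner_diff_left inner_diff_right nn inner_commute[of v n] x_def[symmetric] power2_eq_square)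
  also have "\<dots> = (\<Sum>j\<in>UNIV. (n \<bullet> M j)\<^sup>2)"
    by (simp add: inner_vec_def[of "v - _"] nM power2_eq_square)
  also have "\<dots> \<le> (\<Sum>j\<in>UNIV. M j \<bullet> M j)"
    using Cauchy_Schwarz_ineq[of n] by (intro sum_mono) (simp add: nn)
  also have "\<dots> = (\<Sum>i\<in>UNIV. \<Sum>j\<in>UNIV. (D $ i $ j - v $ i * n $ j)\<^sup>2)"
    by (subst sum.swap) (simp add: M_def inner_vec_def power2_eq_square)
  also have "\<dots> = (\<Sum>i\<in>UNIV. (\<Sum>j\<in>UNIV. D $ i $ j * D $ i $ j) - (v $ i)\<^sup>2)"
  proof (rule sum.cong[OF refl])
    fix i
    have "(\<Sum>j\<in>UNIV. (D $ i $ j - v $ i * n $ j)\<^sup>2) = (\<Sum>j\<in>UNIV. D $ i $ j * D $ i $ j)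
        - 2 * v $ i * (\<Sum>j\<in>UNIV. D $ i $ j * n $ j) + (v $ i)\<^sup>2 * (\<Sum>j\<in>UNIV. n $ j * n $ j)"
      by (simp add: sum_distrib_left sum_subtractf[symmetric] sum.distrib[symmetric] power2_eq_square algebra_simps)
    also have "(\<Sum>j\<in>UNIV. n $ j * n $ j) = 1" using nn by (simp add: inner_vec_def)
    finally show "(\<Sum>j\<in>UNIV. (D $ i $ j - v $ i * n $ j)\<^sup>2) = (\<Sum>j\<in>UNIV. D $ i $ j * D $ i $ j) - (v $ i)\<^sup>2"
      by (simp add: v power2_eq_square)
  qed
  also have "\<dots> = ddot D D - v \<bullet> v"
    by (simp add: sum_subtractf ddot_def inner_vec_def power2_eq_square)
  finally show ?thesis by (simp add: v_def x_def power2_norm_eq_inner)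
qed

lemma ddot_outer: "ddot D (outer n n) = n \<bullet> (D *v n)"
  by (simp add: ddot_def outer_def inner_vec_def matrix_vector_mult_def sum_distrib_left mult_ac)

text \<open>
  Relative to \<open>n\<close> the form is diagonal: the three hypotheses are its coefficients on the block orthogonal to \<open>n\<close>,
  on the part of \<open>D *v n\<close> orthogonal to \<open>n\<close>, and on the entry \<open>n \<bullet> (D *v n)\<close>.
\<close>

lemma quadratic_form_nonneg:
  fixes D :: "real^3^3" and n :: "real^3"
  assumes sym: "transpose D = D" and n: "norm n = 1"
    and c: "c2 \<ge> 0" "2 * c2 + c3 \<ge> 0" "c1 + c2 + c3 \<ge> 0"
  shows "c1 * \<bar>ddot D (outer n n)\<bar>\<^sup>2 + c2 * ddot D D + c3 * (norm (D *v n))\<^sup>2 \<ge> 0"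
proof -
  define x where "x = n \<bullet> (D *v n)"
  define w where "w = (norm (D *v n))\<^sup>2"
  have "x\<^sup>2 \<le> w"
    using Cauchy_Schwarz_ineq[of n "D *v n"] n by (simp add: x_def w_def power2_norm_eq_inner norm_eq_1)
  moreover have "2 * w - x\<^sup>2 \<le> ddot D D"
    using symmetric_form_lower_bound[OF sym n] by (simp add: x_def w_def)
  ultimately have "0 \<le> c2 * (ddot D D - (2 * w - x\<^sup>2))" "0 \<le> (2 * c2 + c3) * (w - x\<^sup>2)"
    "0 \<le> (c1 + c2 + c3) * x\<^sup>2"
    using c by simp_all
  then have "0 \<le> c2 * (ddot D D - (2 * w - x\<^sup>2)) + (2 * c2 + c3) * (w - x\<^sup>2) + (c1 + c2 + c3) * x\<^sup>2"
    by linarith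
  then show ?thesis by (simp add: ddot_outer x_def[symmetric] w_def[symmetric] algebra_simps)
qed

section \<open>The dissipation inequality\<close>

theorem theorem8p1:
  fixes \<alpha> \<eta> \<eta>star S2 S4 lam \<alpha>1 \<alpha>2 \<alpha>3 \<alpha>4 \<alpha>5 \<alpha>6 \<gamma>1 \<gamma>2 :: real
    and e :: "real^3" and u0 g0 :: "real \<Rightarrow> real"
  assumes \<eta>star: "\<eta>star > 0" "ratio \<eta>star = alpha_star"
    and \<alpha>: "\<alpha> > alpha_star"
    and \<eta>: "A 0 \<eta> = \<alpha> * (A 2 \<eta> - A 4 \<eta>)" "\<eta> > \<eta>star"
    and e: "norm e = 1"
    and u0: "is_potential \<alpha> \<eta> e u0"
    and g0: "is_bounded_solution u0 g0"
    and lam: "lam = leslie_lambda \<eta> e u0 g0"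
    and S2: "S2 = order_param 2 \<eta> e"
    and S4: "S4 = order_param 4 \<eta> e"
    and \<alpha>1: "\<alpha>1 = - S4 / 2"
    and \<alpha>2: "\<alpha>2 = - (1 / 2) * (1 + 1 / lam) * S2"
    and \<alpha>3: "\<alpha>3 = - (1 / 2) * (1 - 1 / lam) * S2"
    and \<alpha>4: "\<alpha>4 = 4 / 15 - 5 / 21 * S2 - 1 / 35 * S4"
    and \<alpha>5: "\<alpha>5 = 1 / 7 * S4 + 6 / 7 * S2"
    and \<alpha>6: "\<alpha>6 = 1 / 7 * S4 - 1 / 7 * S2"
    and \<gamma>1: "\<gamma>1 = \<alpha>3 - \<alpha>2"
    and \<gamma>2: "\<gamma>2 = \<alpha>6 - \<alpha>5"
  shows "\<forall>(D :: real^3^3) (n :: real^3). transpose D = D \<and> norm n = 1 \<longrightarrow>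
      (\<alpha>1 + \<gamma>2\<^sup>2 / \<gamma>1) * \<bar>ddot D (outer n n)\<bar>\<^sup>2 + \<alpha>4 * ddot D D
        + (\<alpha>5 + \<alpha>6 - \<gamma>2\<^sup>2 / \<gamma>1) * (norm (D *v n))\<^sup>2 \<ge> 0"
proof -
  define a where "a = A 2 \<eta> / A 0 \<eta>"
  define b where "b = A 4 \<eta> / A 0 \<eta>"
  define G where "G = avg (h \<eta> e) (\<lambda>m. g0 (arccos (m \<bullet> e)) * deriv u0 (arccos (m \<bullet> e)))"
  note A0 = A_0_pos[of \<eta>]
  have \<eta>_pos: "\<eta> > 0" using \<eta>star(1) \<eta>(2) by simp
  have ab: "b \<le> a" "a \<le> 1"
    using A_4_le_A_2[of \<eta>] A_2_le_A_0[of \<eta>] A0 by (simp_all add: a_def b_def divide_right_mono)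
  have parts: "3 * a - 1 = 2 * \<eta> * (a - b)"
    using A_parts[of \<eta>] A0 by (simp add: a_def b_def field_simps)
  then have a3: "3 * a - 1 \<ge> 0" using ab \<eta>_pos by simp
  have "\<alpha> * (a - b) = 1"
    using \<eta>(1) A0 by (simp add: a_def b_def field_simps)
  then have "\<alpha> * (3 * a - 1) / 2 = \<eta>"
    unfolding parts by (metis mult.commute mult.left_commute mult.right_neutral nonzero_mult_div_cancel_left zero_neq_numeral)
  then have u: "u0 \<theta> = \<alpha> * (1 + a) / 2 - \<eta> * (cos \<theta>)\<^sup>2" if "\<theta> \<in> {0..pi}" for \<theta>
    using is_potential_eq[OF e u0 that] by (simp add: a_def)
  interpret leslie_problem \<eta> "\<alpha> * (1 + a) / 2" u0 g0
    by unfold_locales (use u g0 in auto)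
  have dual: "(3 * a - 1)\<^sup>2 \<le> G * (1 - 3 * a + 4 * b)"
    using dual_energy_bound[OF e] by (simp add: G_def a_def b_def)
  have S2': "S2 = (3 * a - 1) / 2"
    using S2 order_param_2[OF e, of \<eta>] by (simp add: a_def)
  have S4': "S4 = (35 * b - 30 * a + 3) / 8"
    using S4 order_param_4[OF e, of \<eta>] by (simp add: a_def b_def)
  have lam': "lam = (3 * a - 1) / G"
    using avg_even_polynomial[OF e, of \<eta> "- 1" 3 0] by (simp add: lam leslie_lambda_def G_def a_def)
  \<comment> \<open>\<open>\<gamma>2\<^sup>2 / \<gamma>1 = S2 * lam\<close> also holds if \<open>S2\<close> or \<open>lam\<close> is 0, since both sides are then 0.\<close>
  define k where "k = \<gamma>2\<^sup>2 / \<gamma>1"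
  have "\<gamma>1 = S2 / lam" unfolding \<gamma>1 \<alpha>2 \<alpha>3 by (simp add: field_simps)
  moreover have "\<gamma>2 = - S2" unfolding \<gamma>2 \<alpha>5 \<alpha>6 by simp
  ultimately have "k = S2 * lam"
    by (simp add: k_def power2_eq_square)
  then have k: "k = (3 * a - 1)\<^sup>2 / G / 2"
    by (simp add: lam' S2' power2_eq_square)
  have k_le: "k \<le> (1 - 3 * a + 4 * b) / 2"
  proof (cases "G > 0")
    case True
    then have "(3 * a - 1)\<^sup>2 / G \<le> 1 - 3 * a + 4 * b"
      using dual by (simp add: divide_le_eq mult.commute)
    then show ?thesis by (simp add: k)
  next
    case False
    then have "k \<le> 0" unfolding k by (simp add: divide_nonneg_nonpos)
    also have "0 \<le> (1 - 3 * a + 4 * b) / 2"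
      using A_energy_pos[of \<eta>] A0 by (simp add: a_def b_def field_simps)
    finally show ?thesis .
  qed
  have forms: "\<alpha>4 = (3 - 2 * a - b) / 8" "2 * \<alpha>4 + \<alpha>5 + \<alpha>6 = (1 - a + 2 * b) / 2"
    "\<alpha>1 + \<alpha>4 + \<alpha>5 + \<alpha>6 = (26 * a - 17 * b - 1) / 16"
    unfolding \<alpha>1 \<alpha>4 \<alpha>5 \<alpha>6 S2' S4' by (simp_all add: field_simps)
  have c: "\<alpha>4 \<ge> 0" using forms(1) ab by simp
  have c': "2 * \<alpha>4 + (\<alpha>5 + \<alpha>6 - k) \<ge> 0"
  proof -
    have "k \<le> (1 - a + 2 * b) / 2" using k_le ab(1) by simp
    then show ?thesis using forms(2) by simp
  qed
  have c'': "(\<alpha>1 + k) + \<alpha>4 + (\<alpha>5 + \<alpha>6 - k) \<ge> 0"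
  proof -
    have "0 \<le> (26 * a - 17 * b - 1) / 16" using ab(1) a3 by simp
    then show ?thesis using forms(3) by simp
  qed
  show ?thesis
  proof (intro allI impI, elim conjE)
    fix D :: "real^3^3" and n :: "real^3"
    assume "transpose D = D" "norm n = 1"
    from quadratic_form_nonneg[OF this c c' c'']
    show "(\<alpha>1 + \<gamma>2\<^sup>2 / \<gamma>1) * \<bar>ddot D (outer n n)\<bar>\<^sup>2 + \<alpha>4 * ddot D D
        + (\<alpha>5 + \<alpha>6 - \<gamma>2\<^sup>2 / \<gamma>1) * (norm (D *v n))\<^sup>2 \<ge> 0"
      unfolding k_def .
  qed
qed

end
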